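(* Let $q$ be an odd prime power, $G=\mathrm{GL}(2,\mathbb F_q)$, $C\le G$ the Cartan subgroup and $\nu_0\in\widehat{\mathbb F_{q^2}^*}$ indecomposable, viewed as a one-dimensional representation of $C$. For the multiplicity-free triple $(G,C,\nu_0)$ the following hold, for all $x\in\mathbb F_q^*$, $y\in\mathbb F_q$ and $(a,b)\in\mathbb F_q^2\setminus\{(0,0)\}$. (1) The spherical function associated with the parabolic representation $\widehat\chi_{\psi_1,\psi_2}$ (where $\psi_1,\psi_2\in\widehat{\mathbb F_q^*}$, $\psi_1\neq\psi_2$, satisfy $\nu_0^\sharp=\psi_1\psi_2$) is given by $$\phi^{\psi_1,\psi_2}\left[\begin{pmatrix} x & y \\ 0 & 1 \end{pmatrix}\begin{pmatrix} a & \eta b \\ b & a \end{pmatrix}\right]=\frac{\overline{\nu_0(a+ib)}}{q+1}\left[\sum_{\gamma\in\mathbb F_q}\nu_0(\gamma+i)\overline{\nu_0(x\gamma+y+i)}\,\psi_2\!\left(\frac{(x\gamma+y)^2-\eta}{x(\gamma^2-\eta)}\right)+\overline{\psi_1(x)}\right].$$ (2) The spherical function associated with $\widehat\chi^1_\psi$ (where $\psi\in\widehat{\mathbb F_q^*}$ satisfies $\nu_0^\sharp=\psi^2$) is given by $$\phi^{\psi}\left[\begin{pmatrix} x & y \\ 0 & 1 \end{pmatrix}\begin{pmatrix} a & \eta b \\ b & a \end{pmatrix}\right]=\frac{\overline{\nu_0(a+ib)}}{q+1}\left[\sum_{\gamma\in\mathbb F_q}\nu_0(\gamma+i)\overline{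\nu_0(x\gamma+y+i)}\,\psi\!\left(\frac{(x\gamma+y)^2-\eta}{x(\gamma^2-\eta)}\right)+\overline{\psi(x)}\right].$$
   Context: $\eta$ is a generator of $\mathbb F_q^*$, $\mathbb F_{q^2}=\mathbb F_q(i)$ with $i^2=\eta$, $\overline{\alpha+i\beta}=\alpha-i\beta$ (while $\overline{\nu_0(z)}$ and $\overline{\psi(x)}$ denote complex conjugates of complex numbers). $C=\left\{\begin{pmatrix} a & \eta b \\ b & a \end{pmatrix}:(a,b)\ne(0,0)\right\}\cong\mathbb F_{q^2}^*$ via $\begin{pmatrix} a & \eta b \\ b & a \end{pmatrix}\mapsto a+ib$. Every element of $G$ is uniquely a product $\begin{pmatrix} x & y \\ 0 & 1 \end{pmatrix}\begin{pmatrix} a & \eta b \\ b & a \end{pmatrix}$ with $x\in\mathbb F_q^*$, $y\in\mathbb F_q$, $(a,b)\ne(0,0)$. For $\nu\in\widehat{\mathbb F_{q^2}^*}$, $\nu^\sharp=\nu|_{\mathbb F_q^*}$; $\nu$ is decomposable if $\nu(w)=\psi(w\overline w)$ for some $\psi\in\widehat{\mathbb F_q^*}$, otherwise indecomposable. $B$ is the group of upper triangular matrices in $G$, $\chi_{\psi_1,\psi_2}\begin{pmatrix} \alpha & \beta \\ 0 & \delta \end{pmatrix}=\psi_1(\alpha)\psi_2(\delta)$, $\widehat\chi_{\psi_1,\psi_2}=\mathrm{Ind}_B^G\chi_{\psi_1,\psi_2}$ (irreducible if $\psi_1\ne\psi_2$); $\widehat\chi_{\psi,\psi}=\widehat\chi^0_\psi\oplus\widehat\chi^1_\psi$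 with $\widehat\chi^0_\psi(g)=\psi(\det g)$ and $\widehat\chi^1_\psi$ irreducible of dimension $q$. These representations are contained, with multiplicity one, in $\mathrm{Ind}_C^G\nu_0$ under the stated conditions. The spherical function of $(G,C,\nu_0)$ associated with an irreducible unitary $G$-representation $(\sigma,W)$ contained in $\mathrm{Ind}_C^G\nu_0$ is $\phi^\sigma(g)=\langle w,\sigma(g)w\rangle$ (inner product conjugate-linear in the second argument), where $w\in W$ is the unit vector, unique up to a unimodular scalar, with $\sigma(c)w=\nu_0(c)w$ for all $c\in C$. *)

theory Defs
  imports
    "HOL-Analysis.Analysis"
    "HOL-Library.Function_Algebras"
    "HOL-Algebra.Algebraic_Closure_Type"
    "HOL-Algebra.Generated_Groups"
begin

text \<open>
  Representation spaces are complex subspaces of function spaces, with the pointwise operations.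
\<close>

definition fscale :: "complex \<Rightarrow> ('x \<Rightarrow> complex) \<Rightarrow> 'x \<Rightarrow> complex" where
  "fscale c f = (\<lambda>x. c * f x)"

interpretation cfun: vector_space fscale
  by unfold_locales (auto simp: fscale_def algebra_simps fun_eq_iff)


section \<open>Unitary representations of a group\<close>

record ('g, 'x) urep =
  rep_space :: "('x \<Rightarrow> complex) set"
  rep_act :: "'g \<Rightarrow> ('x \<Rightarrow> complex) \<Rightarrow> 'x \<Rightarrow> complex"
  rep_inner :: "('x \<Rightarrow> complex) \<Rightarrow> ('x \<Rightarrow> complex) \<Rightarrow> complex"

text \<open>Inner products are linear in the first and conjugate-linear in the second argument.\<close>

definition hermitian_inner_on ::
  "('x \<Rightarrow> complex) set \<Rightarrow> (('x \<Rightarrow> complex) \<Rightarrow> ('x \<Rightarrow> complex) \<Rightarrow> complex) \<Rightarrow> bool" where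
  "hermitian_inner_on V ip \<longleftrightarrow>
     (\<forall>u\<in>V. \<forall>v\<in>V. \<forall>w\<in>V. ip (u + v) w = ip u w + ip v w) \<and>
     (\<forall>c. \<forall>u\<in>V. \<forall>w\<in>V. ip (fscale c u) w = c * ip u w) \<and>
     (\<forall>u\<in>V. \<forall>w\<in>V. ip w u = cnj (ip u w)) \<and>
     (\<forall>u\<in>V. u \<noteq> 0 \<longrightarrow> ip u u \<in> \<real> \<and> Re (ip u u) > 0)"

definition linear_between ::
  "('x \<Rightarrow> complex) set \<Rightarrow> ('y \<Rightarrow> complex) set \<Rightarrow> (('x \<Rightarrow> complex) \<Rightarrow> 'y \<Rightarrow> complex) \<Rightarrow> bool" where
  "linear_between V W T \<longleftrightarrow>
     T ` V \<subseteq> W \<and>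
     (\<forall>u\<in>V. \<forall>v\<in>V. T (u + v) = T u + T v) \<and>
     (\<forall>c. \<forall>u\<in>V. T (fscale c u) = fscale c (T u))"

definition unitary_representation :: "('g, 'm) monoid_scheme \<Rightarrow> ('g, 'x) urep \<Rightarrow> bool" where
  "unitary_representation G \<rho> \<longleftrightarrow>
     cfun.subspace (rep_space \<rho>) \<and>
     (\<exists>S. finite S \<and> rep_space \<rho> \<subseteq> cfun.span S) \<and>
     hermitian_inner_on (rep_space \<rho>) (rep_inner \<rho>) \<and>
     (\<forall>g\<in>carrier G. linear_between (rep_space \<rho>) (rep_space \<rho>) (rep_act \<rho> g)) \<and>
     (\<forall>v\<in>rep_space \<rho>. rep_act \<rho> \<one>\<^bsub>G\<^esub> v = v) \<and>
     (\<forall>g\<in>carrier G. \<forall>h\<in>carrier G. \<forall>v\<in>rep_space \<rho>.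
        rep_act \<rho> (g \<otimes>\<^bsub>G\<^esub> h) v = rep_act \<rho> g (rep_act \<rho> h v)) \<and>
     (\<forall>g\<in>carrier G. \<forall>u\<in>rep_space \<rho>. \<forall>v\<in>rep_space \<rho>.
        rep_inner \<rho> (rep_act \<rho> g u) (rep_act \<rho> g v) = rep_inner \<rho> u v)"

definition irreducible_representation :: "('g, 'm) monoid_scheme \<Rightarrow> ('g, 'x) urep \<Rightarrow> bool" where
  "irreducible_representation G \<rho> \<longleftrightarrow>
     rep_space \<rho> \<noteq> {0} \<and>
     (\<forall>U. cfun.subspace U \<longrightarrow> U \<subseteq> rep_space \<rho> \<longrightarrow>
        (\<forall>g\<in>carrier G. rep_act \<rho> g ` U \<subseteq> U) \<longrightarrow> U = {0} \<or> U = rep_space \<rho>)"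

definition contained_in_representation ::
  "('g, 'm) monoid_scheme \<Rightarrow> ('g, 'x) urep \<Rightarrow> ('g, 'y) urep \<Rightarrow> bool" where
  "contained_in_representation G \<rho> \<rho>' \<longleftrightarrow>
     (\<exists>T. linear_between (rep_space \<rho>) (rep_space \<rho>') T \<and>
          inj_on T (rep_space \<rho>) \<and>
          (\<forall>g\<in>carrier G. \<forall>v\<in>rep_space \<rho>. T (rep_act \<rho> g v) = rep_act \<rho>' g (T v)))"

text \<open>
  \<open>Ind\<^sub>K\<^sup>G \<theta>\<close> for a one-dimensional representation \<open>\<theta>\<close> of \<open>K\<close>: functions on \<open>G\<close> with
  \<open>f (g k) = \<theta> (k\<^sup>-\<^sup>1) f g\<close>, under left translation. Functions are extended by zero outside the
  carrier, so that they form a subspace of the full function space.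
\<close>

definition induced_rep ::
  "('g, 'm) monoid_scheme \<Rightarrow> 'g set \<Rightarrow> ('g \<Rightarrow> complex) \<Rightarrow> ('g, 'g) urep" where
  "induced_rep G K \<theta> =
     \<lparr> rep_space = {f. (\<forall>g\<in>carrier G. \<forall>k\<in>K. f (g \<otimes>\<^bsub>G\<^esub> k) = \<theta> (inv\<^bsub>G\<^esub> k) * f g) \<and>
                       (\<forall>g. g \<notin> carrier G \<longrightarrow> f g = 0)},
       rep_act = (\<lambda>g f h. if h \<in> carrier G then f (inv\<^bsub>G\<^esub> g \<otimes>\<^bsub>G\<^esub> h) else 0),
       rep_inner = (\<lambda>f1 f2. (\<Sum>g\<in>carrier G. f1 g * cnj (f2 g)) / of_nat (card K)) \<rparr>"


section \<open>Spherical functions\<close>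

definition spherical_vector ::
  "'g set \<Rightarrow> ('g \<Rightarrow> complex) \<Rightarrow> ('g, 'x) urep \<Rightarrow> ('x \<Rightarrow> complex) \<Rightarrow> bool" where
  "spherical_vector K \<theta> \<rho> w \<longleftrightarrow>
     w \<in> rep_space \<rho> \<and> rep_inner \<rho> w w = 1 \<and> (\<forall>k\<in>K. rep_act \<rho> k w = fscale (\<theta> k) w)"

text \<open>
  The conditions under which a representation has an associated spherical function;
  they make \<open>spherical_function\<close> below independent of the choice of the vector.
\<close>

definition has_spherical_function ::
  "('g, 'm) monoid_scheme \<Rightarrow> 'g set \<Rightarrow> ('g \<Rightarrow> complex) \<Rightarrow> ('g, 'x) urep \<Rightarrow> bool" where
  "has_spherical_function G K \<theta> \<sigma> \<longleftrightarrow>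
     unitary_representation G \<sigma> \<and>
     irreducible_representation G \<sigma> \<and>
     contained_in_representation G \<sigma> (induced_rep G K \<theta>) \<and>
     (\<exists>w. spherical_vector K \<theta> \<sigma> w) \<and>
     (\<forall>w w'. spherical_vector K \<theta> \<sigma> w \<longrightarrow> spherical_vector K \<theta> \<sigma> w' \<longrightarrow>
        (\<exists>c. cmod c = 1 \<and> w' = fscale c w))"

definition spherical_function ::
  "'g set \<Rightarrow> ('g \<Rightarrow> complex) \<Rightarrow> ('g, 'x) urep \<Rightarrow> 'g \<Rightarrow> complex" where
  "spherical_function K \<theta> \<sigma> g =
     (let w = SOME w. spherical_vector K \<theta> \<sigma> w in rep_inner \<sigma> w (rep_act \<sigma> g w))"


section \<open>Characters and the quadratic extension\<close>

definition circle_group :: "complex monoid" where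
  "circle_group = \<lparr> carrier = {z. cmod z = 1}, mult = (*), one = 1 \<rparr>"

text \<open>Extensionality makes equality of characters mean equality on the group.\<close>

definition characters :: "('g, 'm) monoid_scheme \<Rightarrow> ('g \<Rightarrow> complex) set" where
  "characters A = hom A circle_group \<inter> extensional (carrier A)"

text \<open>Two constants \<open>mult_of\<close> exist in HOL-Algebra; they have the same definition.\<close>

abbreviation Fstar :: "'a::{field,finite} monoid" where
  "Fstar \<equiv> mult_of ring_of_type_algebra"

definition field_generator :: "'a::{field,finite} \<Rightarrow> bool" where
  "field_generator \<eta> \<longleftrightarrow> \<eta> \<in> carrier Fstar \<and> generate Fstar {\<eta>} = carrier Fstar"

text \<open>The pair \<open>(a, b)\<close> stands for \<open>a + i b\<close>, where \<open>i\<^sup>2 = \<eta>\<close>.\<close>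

definition quad_ext :: "'a::{field,finite} \<Rightarrow> ('a \<times> 'a) ring" where
  "quad_ext \<eta> =
     \<lparr> carrier = UNIV,
       mult = (\<lambda>(a, b) (c, d). (a * c + \<eta> * (b * d), a * d + b * c)),
       one = (1, 0),
       zero = (0, 0),
       add = (\<lambda>(a, b) (c, d). (a + c, b + d)) \<rparr>"

definition quad_conj :: "'a::{field,finite} \<times> 'a \<Rightarrow> 'a \<times> 'a" where
  "quad_conj = (\<lambda>(a, b). (a, - b))"

definition sharp :: "('a::{field,finite} \<times> 'a \<Rightarrow> complex) \<Rightarrow> 'a \<Rightarrow> complex" where
  "sharp \<nu> = (\<lambda>t\<in>carrier Fstar. \<nu> (t, 0))"

text \<open>The product of \<open>w\<close> and its conjugate lies in the base field, whence the first projection.\<close>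

definition decomposable :: "'a::{field,finite} \<Rightarrow> ('a \<times> 'a \<Rightarrow> complex) \<Rightarrow> bool" where
  "decomposable \<eta> \<nu> \<longleftrightarrow>
     (\<exists>\<psi>\<in>characters Fstar. \<forall>w\<in>carrier (Ring_Divisibility.mult_of (quad_ext \<eta>)).
        \<nu> w = \<psi> (fst (w \<otimes>\<^bsub>quad_ext \<eta>\<^esub> quad_conj w)))"


section \<open>The group \<open>GL(2, F)\<close>, its subgroups and parabolic representations\<close>

definition GL2 :: "('a::{field,finite}^2^2) monoid" where
  "GL2 = \<lparr> carrier = {A. invertible A}, mult = (**), one = mat 1 \<rparr>"

definition mat2 :: "'a::{field,finite} \<Rightarrow> 'a \<Rightarrow> 'a \<Rightarrow> 'a \<Rightarrow> 'a^2^2" where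
  "mat2 a b c d = vector [vector [a, b], vector [c, d]]"

definition cartan_subgroup :: "'a::{field,finite} \<Rightarrow> ('a^2^2) set" where
  "cartan_subgroup \<eta> = {mat2 a (\<eta> * b) b a | a b. (a, b) \<noteq> (0, 0)}"

text \<open>A character of the quadratic extension, transported to \<open>cartan_subgroup \<eta>\<close>.\<close>

definition cartan_char :: "('a::{field,finite} \<times> 'a \<Rightarrow> complex) \<Rightarrow> 'a^2^2 \<Rightarrow> complex" where
  "cartan_char \<nu> A = \<nu> (A $ 1 $ 1, A $ 2 $ 1)"

definition borel_subgroup :: "('a::{field,finite}^2^2) set" where
  "borel_subgroup = {A \<in> carrier GL2. A $ 2 $ 1 = 0}"

definition borel_char ::
  "('a::{field,finite} \<Rightarrow> complex) \<Rightarrow> ('a \<Rightarrow> complex) \<Rightarrow> 'a^2^2 \<Rightarrow> complex" where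
  "borel_char \<psi>1 \<psi>2 A = \<psi>1 (A $ 1 $ 1) * \<psi>2 (A $ 2 $ 2)"

definition parabolic_rep ::
  "('a::{field,finite} \<Rightarrow> complex) \<Rightarrow> ('a \<Rightarrow> complex) \<Rightarrow> ('a^2^2, 'a^2^2) urep" where
  "parabolic_rep \<psi>1 \<psi>2 = induced_rep GL2 borel_subgroup (borel_char \<psi>1 \<psi>2)"

text \<open>
  The summands of \<open>parabolic_rep \<psi> \<psi>\<close>: the subspace on which the group acts by \<open>\<psi> \<circ> det\<close>, and
  its orthogonal complement.
\<close>

definition parabolic_rep0 :: "('a::{field,finite} \<Rightarrow> complex) \<Rightarrow> ('a^2^2, 'a^2^2) urep" where
  "parabolic_rep0 \<psi> = (let \<rho> = parabolic_rep \<psi> \<psi> in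
     \<rho>\<lparr>rep_space := {f \<in> rep_space \<rho>. \<forall>g\<in>carrier GL2. rep_act \<rho> g f = fscale (\<psi> (det g)) f}\<rparr>)"

definition parabolic_rep1 :: "('a::{field,finite} \<Rightarrow> complex) \<Rightarrow> ('a^2^2, 'a^2^2) urep" where
  "parabolic_rep1 \<psi> = (let \<rho> = parabolic_rep \<psi> \<psi> in
     \<rho>\<lparr>rep_space := {f \<in> rep_space \<rho>. \<forall>h\<in>rep_space (parabolic_rep0 \<psi>). rep_inner \<rho> f h = 0}\<rparr>)"

end

(* Irreducibility: averaging over B against \<chi>, any nonzero invariant subspace contains an eigenvector
   of B that does not vanish at the identity; by the Bruhat decomposition such an eigenvector is the
   function supported on B, up to a multiple of \<psi> o det when \<psi>1 = \<psi>2 = \<psi>, and its translates span.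

   Since G = C B and C meets B in the centre, the condition on the restriction of \<nu> to the centre
   leaves, up to a scalar, exactly one \<nu>-eigenvector of C in the induced space. Its values are explicit,
   and its matrix coefficient is a sum over the representatives of G/B given by the identity and the
   elements \<gamma> + i of C. For \<psi>1 = \<psi>2 it is orthogonal to the one-dimensional summand because some
   element of C separates \<nu> from \<psi> o det, \<nu> being indecomposable. *)

theory Submission
  imports Defs "HOL-Number_Theory.Residues"
begin

text \<open>A spherical function is defined through a chosen unit vector, so irreducibility,
  containment in the representation induced from \<open>C\<close>, and uniqueness of the vector up
  to a phase have to be established along with the formula. Uniqueness is read off from
  \<open>G = C B\<close> rather than from multiplicity-freeness, and containment follows from the
  mere existence of the vector. Oddness of \<open>q\<close> and the choice of \<eta> act through a
  single fact: \<eta> is not a square, so \<open>a\<^sup>2 - \<eta> b\<^sup>2\<close> vanishes only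
  at the origin. This makes \<open>C\<close> a group, makes the elements \<open>\<gamma> + i\<close>
  invertible, and yields \<open>G = C B\<close>. The factor \<open>1/(q+1)\<close> appears because
  the eigenvector has modulus 1 on the whole group, so its squared norm is the number of cosets of
  \<open>B\<close>. Both families share one computation, in which \<psi>1 and \<psi>2 may coincide;
  only the invariant subspace around the eigenvector changes.\<close>

unbundle no fps_syntax

section \<open>Unitary representations\<close>

lemma sum_cfun_apply: "(\<Sum>i\<in>A. (f i :: 'x \<Rightarrow> complex)) x = (\<Sum>i\<in>A. f i x)"
  by (induction A rule: infinite_finite_induct) auto

lemma fscale_apply [simp]: "fscale c f x = c * f x"
  by (simp add: fscale_def)

text \<open>Point indicators span the functions vanishing off a finite set; this bounds the
  dimension of induced spaces.\<close>

lemma finite_support_span: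
  assumes "finite A" "\<And>x. x \<notin> A \<Longrightarrow> f x = (0::complex)"
  shows "f \<in> cfun.span ((\<lambda>a x. if x = a then 1 else 0) ` A)"
proof -
  have "f = (\<Sum>a\<in>A. fscale (f a) (\<lambda>x. if x = a then 1 else 0))"
  proof
    fix x
    have "(\<Sum>a\<in>A. f a * (if x = a then 1 else 0)) = (\<Sum>a\<in>A. if a = x then f a else 0)"
      by (rule sum.cong) auto
    also have "\<dots> = f x"
      using assms by (simp add: sum.delta)
    finally show "f x = (\<Sum>a\<in>A. fscale (f a) (\<lambda>x. if x = a then 1 else 0)) x"
      by (simp add: sum_cfun_apply)
  qed
  also have "\<dots> \<in> cfun.span ((\<lambda>a x. if x = a then 1 else 0) ` A)"
    by (intro cfun.span_sum cfun.span_scale cfun.span_base) auto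
  finally show ?thesis .
qed

lemma hermitian_inner_onD:
  assumes "hermitian_inner_on V ip"
  shows hermitian_add_left: "\<lbrakk>u \<in> V; v \<in> V; w \<in> V\<rbrakk> \<Longrightarrow> ip (u + v) w = ip u w + ip v w"
    and hermitian_scale_left: "\<lbrakk>u \<in> V; w \<in> V\<rbrakk> \<Longrightarrow> ip (fscale c u) w = c * ip u w"
    and hermitian_sym: "\<lbrakk>u \<in> V; w \<in> V\<rbrakk> \<Longrightarrow> ip w u = cnj (ip u w)"
  using assms unfolding hermitian_inner_on_def by meson+

lemma unitary_representationD:
  assumes "unitary_representation G \<rho>"
  shows unitary_subspace: "cfun.subspace (rep_space \<rho>)"
    and unitary_finite_dim: "\<exists>S. finite S \<and> rep_space \<rho> \<subseteq> cfun.span S"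
    and unitary_hermitian: "hermitian_inner_on (rep_space \<rho>) (rep_inner \<rho>)"
    and unitary_closed: "\<lbrakk>g \<in> carrier G; v \<in> rep_space \<rho>\<rbrakk> \<Longrightarrow> rep_act \<rho> g v \<in> rep_space \<rho>"
    and unitary_add: "\<lbrakk>g \<in> carrier G; u \<in> rep_space \<rho>; v \<in> rep_space \<rho>\<rbrakk>
      \<Longrightarrow> rep_act \<rho> g (u + v) = rep_act \<rho> g u + rep_act \<rho> g v"
    and unitary_scale: "\<lbrakk>g \<in> carrier G; u \<in> rep_space \<rho>\<rbrakk>
      \<Longrightarrow> rep_act \<rho> g (fscale c u) = fscale c (rep_act \<rho> g u)"
    and unitary_one: "v \<in> rep_space \<rho> \<Longrightarrow> rep_act \<rho> \<one>\<^bsub>G\<^esub> v = v"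
    and unitary_mult: "\<lbrakk>g \<in> carrier G; h \<in> carrier G; v \<in> rep_space \<rho>\<rbrakk>
      \<Longrightarrow> rep_act \<rho> (g \<otimes>\<^bsub>G\<^esub> h) v = rep_act \<rho> g (rep_act \<rho> h v)"
    and unitary_isometry: "\<lbrakk>g \<in> carrier G; u \<in> rep_space \<rho>; v \<in> rep_space \<rho>\<rbrakk>
      \<Longrightarrow> rep_inner \<rho> (rep_act \<rho> g u) (rep_act \<rho> g v) = rep_inner \<rho> u v"
  using assms by (simp_all add: unitary_representation_def linear_between_def image_subset_iff)

lemma unitary_representation_restrict:
  assumes \<rho>: "unitary_representation G \<rho>"
    and W: "cfun.subspace W" "W \<subseteq> rep_space \<rho>"
      "\<And>g v. \<lbrakk>g \<in> carrier G; v \<in> W\<rbrakk> \<Longrightarrow> rep_act \<rho> g v \<in> W"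
  shows "unitary_representation G (\<rho>\<lparr>rep_space := W\<rparr>)"
proof -
  have "\<exists>S. finite S \<and> W \<subseteq> cfun.span S"
    using unitary_finite_dim[OF \<rho>] W(2) by (meson subset_trans)
  moreover have "hermitian_inner_on W (rep_inner \<rho>)"
    using unitary_hermitian[OF \<rho>] W(2) unfolding hermitian_inner_on_def by (meson subsetD)
  moreover have "linear_between W W (rep_act \<rho> g)" if "g \<in> carrier G" for g
    using that W(2,3) unitary_add[OF \<rho> that] unitary_scale[OF \<rho> that]
    unfolding linear_between_def by (intro conjI ballI allI) (blast+)
  ultimately show ?thesis
    using W(1) subsetD[OF W(2)]
    unfolding unitary_representation_def
    by (simp add: unitary_one[OF \<rho>] unitary_mult[OF \<rho>] unitary_isometry[OF \<rho>])
qed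

text \<open>Left translation commutes with the equivariance condition on the right, so it preserves
  the space; it permutes the group, so it preserves the sum in the inner product.\<close>

lemma unitary_representation_induced:
  fixes G (structure)
  assumes "group G" "finite (carrier G)" "K \<subseteq> carrier G" "K \<noteq> {}"
  shows "unitary_representation G (induced_rep G K \<theta>)"
proof -
  interpret group G by fact
  have K: "card K > 0"
    using assms finite_subset card_gt_0_iff by metis
  let ?V = "rep_space (induced_rep G K \<theta>)"
  have 1: "cfun.subspace ?V"
    by (auto simp: cfun.subspace_def induced_rep_def algebra_simps)
  have 2: "\<exists>S. finite S \<and> ?V \<subseteq> cfun.span S"
    using finite_support_span[OF assms(2)] assms(2)
    by (intro exI[of _ "(\<lambda>a x. if x = a then 1 else 0) ` carrier G"]) (auto simp: induced_rep_def)
  have 3: "hermitian_inner_on ?V (rep_inner (induced_rep G K \<theta>))"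
  proof -
    have "(\<Sum>g\<in>carrier G. u g * cnj (u g)) / of_nat (card K) \<in> \<real> \<and>
        Re ((\<Sum>g\<in>carrier G. u g * cnj (u g)) / of_nat (card K)) > 0"
      if u: "u \<in> ?V" "u \<noteq> 0" for u
    proof -
      obtain g where "u g \<noteq> 0"
        using u(2) by (auto simp: fun_eq_iff)
      moreover from this have "g \<in> carrier G"
        using u(1) by (auto simp: induced_rep_def)
      ultimately have "(\<Sum>g\<in>carrier G. (cmod (u g))\<^sup>2) > 0"
        using assms(2) by (intro sum_pos2[of _ g]) auto
      moreover have "(\<Sum>g\<in>carrier G. u g * cnj (u g)) / of_nat (card K) =
          of_real ((\<Sum>g\<in>carrier G. (cmod (u g))\<^sup>2) / card K)"
        by (simp add: complex_mult_cnj cmod_def)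
      ultimately show ?thesis
        using K by (simp add: divide_pos_pos del: of_real_divide of_real_sum)
    qed
    then show ?thesis
      unfolding hermitian_inner_on_def
      by (auto simp: induced_rep_def algebra_simps sum.distrib add_divide_distrib sum_distrib_left)
  qed
  have 4: "linear_between ?V ?V (rep_act (induced_rep G K \<theta>) g)" if "g \<in> carrier G" for g
    using that assms(3)
    by (auto simp: linear_between_def induced_rep_def fun_eq_iff m_assoc[symmetric] subset_iff)
  have 5: "rep_act (induced_rep G K \<theta>) \<one>\<^bsub>G\<^esub> v = v" if "v \<in> ?V" for v
    using that by (auto simp: induced_rep_def fun_eq_iff)
  have 6: "rep_act (induced_rep G K \<theta>) (g \<otimes>\<^bsub>G\<^esub> h) v =
      rep_act (induced_rep G K \<theta>) g (rep_act (induced_rep G K \<theta>) h v)"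
    if "g \<in> carrier G" "h \<in> carrier G" for g h v
    using that by (auto simp: induced_rep_def fun_eq_iff inv_mult_group m_assoc)
  have 7: "rep_inner (induced_rep G K \<theta>) (rep_act (induced_rep G K \<theta>) g u)
      (rep_act (induced_rep G K \<theta>) g v) = rep_inner (induced_rep G K \<theta>) u v"
    if "g \<in> carrier G" for g u v
  proof -
    have "(\<Sum>h\<in>carrier G. u (inv g \<otimes> h) * cnj (v (inv g \<otimes> h))) =
        (\<Sum>h\<in>carrier G. u h * cnj (v h))"
      using that
      by (intro sum.reindex_bij_witness[of _ "\<lambda>h. g \<otimes> h" "\<lambda>h. inv g \<otimes> h"])
        (auto simp: m_assoc[symmetric])
    then show ?thesis
      by (simp add: induced_rep_def)
  qed
  show ?thesis
    unfolding unitary_representation_def using 1 2 3 4 5 6 7 by blast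
qed

text \<open>Frobenius reciprocity: a spherical vector \<open>w\<close> yields the embedding \<open>v \<mapsto> (g \<mapsto> \<langle>v, \<sigma>(g) w\<rangle>)\<close>.\<close>

lemma contained_in_induced_rep:
  fixes G (structure)
  assumes "group G" and K: "subgroup K G"
    and \<theta>: "\<And>k. k \<in> K \<Longrightarrow> \<theta> (inv k) = cnj (\<theta> k)"
    and \<sigma>: "unitary_representation G \<sigma>" and irr: "irreducible_representation G \<sigma>"
    and w: "spherical_vector K \<theta> \<sigma> w"
  shows "contained_in_representation G \<sigma> (induced_rep G K \<theta>)"
proof -
  interpret group G by fact
  let ?V = "rep_space \<sigma>"
  note H = unitary_hermitian[OF \<sigma>] and V = unitary_subspace[OF \<sigma>] and cl = unitary_closed[OF \<sigma>]
  have wV: "w \<in> ?V" and w1: "rep_inner \<sigma> w w = 1"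
    and wK: "\<And>k. k \<in> K \<Longrightarrow> rep_act \<sigma> k w = fscale (\<theta> k) w"
    using w by (auto simp: spherical_vector_def)
  have scale_right: "rep_inner \<sigma> u (fscale c v) = cnj c * rep_inner \<sigma> u v"
    if "u \<in> ?V" "v \<in> ?V" for u v c
    using that hermitian_sym[OF H] hermitian_scale_left[OF H] cfun.subspace_scale[OF V]
    by (metis complex_cnj_mult)
  define T where "T v = (\<lambda>g. if g \<in> carrier G then rep_inner \<sigma> v (rep_act \<sigma> g w) else 0)" for v
  have K_sub: "k \<in> carrier G" if "k \<in> K" for k
    using that subgroup.subset[OF K] by blast
  have "T v \<in> rep_space (induced_rep G K \<theta>)" if "v \<in> ?V" for v
    using that wV wK cl K_sub \<theta> unitary_mult[OF \<sigma>] unitary_scale[OF \<sigma>]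
    by (auto simp: T_def induced_rep_def scale_right)
  moreover have T_add: "T (u + v) = T u + T v" if "u \<in> ?V" "v \<in> ?V" for u v
    using that wV cl by (auto simp: T_def fun_eq_iff hermitian_add_left[OF H])
  moreover have T_scale: "T (fscale c u) = fscale c (T u)" if "u \<in> ?V" for u c
    using that wV cl by (auto simp: T_def fun_eq_iff hermitian_scale_left[OF H])
  moreover have T_act: "T (rep_act \<sigma> g v) = rep_act (induced_rep G K \<theta>) g (T v)"
    if g: "g \<in> carrier G" and v: "v \<in> ?V" for g v
  proof -
    have "rep_inner \<sigma> (rep_act \<sigma> g v) (rep_act \<sigma> h w) = rep_inner \<sigma> v (rep_act \<sigma> (inv g \<otimes> h) w)"
      if h: "h \<in> carrier G" for h
    proof -
      \<comment> \<open>Exposing a factor \<open>g\<close> on the right of the inner product lets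
        unitarity cancel it on both sides.\<close>
      have "rep_act \<sigma> h w = rep_act \<sigma> (g \<otimes> (inv g \<otimes> h)) w"
        using g h by (simp add: m_assoc[symmetric])
      also have "\<dots> = rep_act \<sigma> g (rep_act \<sigma> (inv g \<otimes> h) w)"
        using g h wV by (intro unitary_mult[OF \<sigma>]) auto
      finally show ?thesis
        using g h v wV by (simp add: unitary_isometry[OF \<sigma>] cl)
    qed
    then show ?thesis
      using g by (auto simp: T_def induced_rep_def)
  qed
  \<comment> \<open>The kernel of \<open>T\<close> is invariant and misses \<open>w\<close>, because
    \<open>T w\<close> takes the value 1 at the identity; irreducibility makes it zero.\<close>
  moreover have "inj_on T ?V"
  proof -
    let ?U = "{v \<in> ?V. T v = 0}"
    have "T w \<one> \<noteq> 0"
      using w1 wV by (simp add: T_def unitary_one[OF \<sigma>])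
    then have "w \<notin> ?U"
      by (auto simp: fun_eq_iff)
    then have "?U \<noteq> ?V"
      using wV by blast
    moreover have "cfun.subspace ?U"
      using T_add T_scale[of 0 0] T_scale cfun.subspace_0[OF V] cfun.subspace_add[OF V]
        cfun.subspace_scale[OF V]
      unfolding cfun.subspace_def by (auto simp: fun_eq_iff)
    moreover have "rep_act \<sigma> g ` ?U \<subseteq> ?U" if "g \<in> carrier G" for g
      using that T_act cl by (auto simp: induced_rep_def fun_eq_iff)
    ultimately have U: "?U = {0}"
      using irr unfolding irreducible_representation_def by (metis (no_types, lifting) mem_Collect_eq subsetI)
    show ?thesis
    proof (rule inj_onI)
      fix u v assume uv: "u \<in> ?V" "v \<in> ?V" "T u = T v"
      let ?d = "u + fscale (- 1) v"
      have v': "fscale (- 1) v \<in> ?V"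
        using uv V by (intro cfun.subspace_scale) auto
      have "T ?d = 0"
        unfolding T_add[OF uv(1) v'] T_scale[OF uv(2)] uv(3) by (auto simp: fun_eq_iff)
      then have "?d \<in> ?U"
        using cfun.subspace_add[OF V uv(1) v'] by simp
      then have "?d = 0"
        unfolding U by simp
      then show "u = v"
        by (auto simp: fun_eq_iff)
    qed
  qed
  ultimately show ?thesis
    unfolding contained_in_representation_def linear_between_def by blast
qed

section \<open>Induction of one-dimensional characters\<close>

locale finite_group_character = group G for G (structure) +
  fixes K \<theta>
  assumes finite_carrier: "finite (carrier G)"
    and subgroup_K: "subgroup K G"
    and char_mult: "\<lbrakk>k \<in> K; l \<in> K\<rbrakk> \<Longrightarrow> \<theta> (k \<otimes> l) = \<theta> k * \<theta> l"
    and char_norm: "k \<in> K \<Longrightarrow> cmod (\<theta> k) = 1"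
begin

abbreviation "ind \<equiv> induced_rep G K \<theta>"

lemma K_subset: "k \<in> K \<Longrightarrow> k \<in> carrier G"
  using subgroup.subset[OF subgroup_K] by blast

lemma K_closed: "k \<in> K \<Longrightarrow> l \<in> K \<Longrightarrow> k \<otimes> l \<in> K" "k \<in> K \<Longrightarrow> inv k \<in> K" "\<one> \<in> K"
  using subgroup.m_closed[OF subgroup_K] subgroup.m_inv_closed[OF subgroup_K]
    subgroup.one_closed[OF subgroup_K] by blast+

lemma finite_K: "finite K" and card_K: "card K > 0"
proof -
  show "finite K"
    using finite_carrier K_subset by (meson finite_subset subsetI)
  then show "card K > 0"
    using K_closed(3) card_gt_0_iff by blast
qed

lemma char_cnj: "k \<in> K \<Longrightarrow> \<theta> k * cnj (\<theta> k) = 1" "k \<in> K \<Longrightarrow> cnj (\<theta> k) * \<theta> k = 1"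
  using char_norm complex_norm_square[of "\<theta> k"] by (auto simp: mult.commute)

lemma char_inv: "k \<in> K \<Longrightarrow> \<theta> (inv k) = cnj (\<theta> k)"
proof -
  assume k: "k \<in> K"
  have "\<theta> \<one> * \<theta> \<one> = \<theta> \<one>" "\<theta> \<one> \<noteq> 0"
    using char_mult[of \<one> \<one>] char_norm[of \<one>] K_closed(3) by auto
  then have "\<theta> (inv k) * \<theta> k = 1"
    using char_mult[of "inv k" k] k K_closed K_subset by auto
  then have "\<theta> (inv k) * (\<theta> k * cnj (\<theta> k)) = cnj (\<theta> k)"
    by (simp add: mult.assoc[symmetric])
  then show ?thesis
    using char_cnj[OF k] by simp
qed

lemma mem_ind_iff:
  "f \<in> rep_space ind \<longleftrightarrow> (\<forall>g\<in>carrier G. \<forall>k\<in>K. f (g \<otimes> k) = cnj (\<theta> k) * f g) \<and>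
     (\<forall>g. g \<notin> carrier G \<longrightarrow> f g = 0)"
  by (auto simp: induced_rep_def char_inv)

lemma act_ind: "rep_act ind g f h = (if h \<in> carrier G then f (inv g \<otimes> h) else 0)"
  by (simp add: induced_rep_def)

lemma inner_ind: "rep_inner ind f1 f2 = (\<Sum>g\<in>carrier G. f1 g * cnj (f2 g)) / of_nat (card K)"
  by (simp add: induced_rep_def)

lemma unitary_ind: "unitary_representation G ind"
  using K_closed(3) K_subset by (intro unitary_representation_induced is_group finite_carrier) auto

text \<open>The member of the induced space that is supported on the identity coset
  \<open>K\<close>.\<close>

definition base_vector where
  "base_vector g = (if g \<in> K then cnj (\<theta> g) else 0)"

text \<open>Only \<open>g\<close> in the coset \<open>h K\<close> contributes, and there the
  equivariance of \<open>v\<close> cancels the character in the base vector, leaving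
  \<open>card K\<close> equal terms. Hence every \<open>v\<close> is a combination of translates of
  \<open>base_vector\<close>.\<close>

lemma convolution_base_vector:
  assumes v: "v \<in> rep_space ind" and h: "h \<in> carrier G"
  shows "(\<Sum>g\<in>carrier G. v g * base_vector (inv g \<otimes> h)) = of_nat (card K) * v h"
proof -
  have "(\<Sum>g\<in>carrier G. v g * base_vector (inv g \<otimes> h)) =
      (\<Sum>g\<in>{g \<in> carrier G. inv g \<otimes> h \<in> K}. v g * cnj (\<theta> (inv g \<otimes> h)))"
    using finite_carrier by (intro sum.mono_neutral_cong_right) (auto simp: base_vector_def)
  also have "\<dots> = (\<Sum>k\<in>K. v (h \<otimes> k) * cnj (\<theta> (inv k)))"
  proof (rule sum.reindex_bij_witness[of _ "\<lambda>k. h \<otimes> k" "\<lambda>g. inv h \<otimes> g"])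
    fix g assume "g \<in> {g \<in> carrier G. inv g \<otimes> h \<in> K}"
    then have g: "g \<in> carrier G" "inv g \<otimes> h \<in> K" by auto
    have e: "inv (inv g \<otimes> h) = inv h \<otimes> g"
      using g h by (simp add: inv_mult_group)
    show "h \<otimes> (inv h \<otimes> g) = g"
      using g h by (simp add: m_assoc[symmetric])
    then show "v (h \<otimes> (inv h \<otimes> g)) * cnj (\<theta> (inv (inv h \<otimes> g))) = v g * cnj (\<theta> (inv g \<otimes> h))"
      using g h by (simp add: inv_mult_group)
    show "inv h \<otimes> g \<in> K"
      using K_closed(2)[OF g(2)] e by simp
  next
    fix k assume k: "k \<in> K"
    show "inv h \<otimes> (h \<otimes> k) = k"
      using k h K_subset by (simp add: m_assoc[symmetric])
    have "inv (h \<otimes> k) \<otimes> h = inv k"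
      using k h K_subset by (simp add: inv_mult_group m_assoc)
    then show "h \<otimes> k \<in> {g \<in> carrier G. inv g \<otimes> h \<in> K}"
      using k h K_subset K_closed by auto
  qed
  also have "\<dots> = (\<Sum>k\<in>K. v h)"
  proof (rule sum.cong)
    fix k assume k: "k \<in> K"
    have "v (h \<otimes> k) * cnj (\<theta> (inv k)) = (cnj (\<theta> k) * \<theta> k) * v h"
      using v h k by (simp add: mem_ind_iff char_inv)
    then show "v (h \<otimes> k) * cnj (\<theta> (inv k)) = v h"
      using char_cnj[OF k] by simp
  qed simp
  finally show ?thesis
    by simp
qed

text \<open>\<open>F\<close> is the unnormalized projection of \<open>f\<close> to the
  \<theta>-eigenspace of \<open>K\<close>. All summands agree at the identity, so the projection
  stays nonzero whenever \<open>f\<close> does not vanish there.\<close>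

lemma character_average:
  assumes f: "f \<in> rep_space ind"
  defines "F \<equiv> \<Sum>k\<in>K. fscale (cnj (\<theta> k)) (rep_act ind k f)"
  shows "l \<in> K \<Longrightarrow> rep_act ind l F = fscale (\<theta> l) F" and "F \<one> = of_nat (card K) * f \<one>"
proof -
  have F: "F h = (\<Sum>k\<in>K. cnj (\<theta> k) * f (inv k \<otimes> h))" if "h \<in> carrier G" for h
    using that by (simp add: F_def sum_cfun_apply act_ind)
  have F0: "F h = 0" if "h \<notin> carrier G" for h
    using that by (simp add: F_def sum_cfun_apply act_ind)
  have "F (inv l \<otimes> h) = \<theta> l * F h" if l: "l \<in> K" and h: "h \<in> carrier G" for l h
  proof -
    have "F (inv l \<otimes> h) = (\<Sum>k\<in>K. cnj (\<theta> k) * f (inv (l \<otimes> k) \<otimes> h))"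
      using l h K_subset by (simp add: F inv_mult_group m_assoc)
    also have "\<dots> = (\<Sum>k\<in>K. cnj (\<theta> (inv l \<otimes> k)) * f (inv k \<otimes> h))"
      using l K_subset K_closed
      by (intro sum.reindex_bij_witness[of _ "\<lambda>k. inv l \<otimes> k" "\<lambda>k. l \<otimes> k"])
        (auto simp: m_assoc[symmetric])
    also have "\<dots> = (\<Sum>k\<in>K. \<theta> l * (cnj (\<theta> k) * f (inv k \<otimes> h)))"
      using l K_closed by (intro sum.cong) (auto simp: char_mult char_inv)
    finally show ?thesis
      using h by (simp add: F sum_distrib_left)
  qed
  then show "rep_act ind l F = fscale (\<theta> l) F" if "l \<in> K"
    using that F0 by (auto simp: act_ind fun_eq_iff)
  have "cnj (\<theta> k) * f (inv k \<otimes> \<one>) = f \<one>" if k: "k \<in> K" for k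
  proof -
    have "f (\<one> \<otimes> inv k) = cnj (\<theta> (inv k)) * f \<one>"
      using f k K_closed one_closed unfolding mem_ind_iff by blast
    then show ?thesis
      using k K_subset char_cnj[OF k] by (simp add: char_inv mult.assoc[symmetric])
  qed
  then show "F \<one> = of_nat (card K) * f \<one>"
    by (simp add: F)
qed

text \<open>
  A nonzero invariant subspace contains an eigenvector \<open>F\<close> of \<open>K\<close> with \<open>F \<one> \<noteq> 0\<close>. If such an
  \<open>F\<close> differs from a multiple of \<^term>\<open>base_vector\<close> by a function that convolution with \<open>W\<close>
  annihilates, then its translates span \<open>W\<close>.
\<close>

lemma irreducible_subrepresentation:
  assumes W: "W \<subseteq> rep_space ind" "W \<noteq> {0}"
    and F: "\<And>F. \<lbrakk>F \<in> W; \<And>k. k \<in> K \<Longrightarrow> rep_act ind k F = fscale (\<theta> k) F; F \<one> \<noteq> 0\<rbrakk> \<Longrightarrow>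
      \<exists>m z. m \<noteq> 0 \<and> (\<forall>h\<in>carrier G. F h = m * base_vector h + z h) \<and>
        (\<forall>v\<in>W. \<forall>h\<in>carrier G. (\<Sum>g\<in>carrier G. v g * z (inv g \<otimes> h)) = 0)"
  shows "irreducible_representation G (ind\<lparr>rep_space := W\<rparr>)"
proof -
  have "U = W" if U: "cfun.subspace U" "U \<subseteq> W" "\<And>g. g \<in> carrier G \<Longrightarrow> rep_act ind g ` U \<subseteq> U"
    and U0: "U \<noteq> {0}" for U
  proof -
    obtain f where f: "f \<in> U" "f \<noteq> 0"
      using U0 cfun.subspace_0[OF U(1)] by blast
    then obtain a where a: "f a \<noteq> 0"
      by (auto simp: fun_eq_iff)
    then have aG: "a \<in> carrier G"
      using f U(2) W by (auto simp: mem_ind_iff)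
    \<comment> \<open>Translation moves a point where \<open>f\<close> is nonzero to the identity,
      so that the average below does not vanish.\<close>
    define f' where "f' = rep_act ind (inv a) f"
    have f': "f' \<in> U" "f' \<one> \<noteq> 0"
      using f a aG U(3)[of "inv a"] by (auto simp: f'_def act_ind)
    then have f'V: "f' \<in> rep_space ind"
      using U(2) W(1) by blast
    define F where "F = (\<Sum>k\<in>K. fscale (cnj (\<theta> k)) (rep_act ind k f'))"
    have FU: "F \<in> U"
      unfolding F_def using U(3) f'(1) K_subset
      by (intro cfun.subspace_sum cfun.subspace_scale U(1)) blast
    have "\<exists>m z. m \<noteq> 0 \<and> (\<forall>h\<in>carrier G. F h = m * base_vector h + z h) \<and>
        (\<forall>v\<in>W. \<forall>h\<in>carrier G. (\<Sum>g\<in>carrier G. v g * z (inv g \<otimes> h)) = 0)"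
    proof (rule F)
      show "F \<in> W" using FU U(2) by blast
      show "rep_act ind k F = fscale (\<theta> k) F" if "k \<in> K" for k
        using character_average(1)[OF f'V that] unfolding F_def .
      show "F \<one> \<noteq> 0"
        using character_average(2)[OF f'V] f'(2) card_K unfolding F_def by simp
    qed
    then obtain m z where m: "m \<noteq> 0"
      and Fz: "\<And>h. h \<in> carrier G \<Longrightarrow> F h = m * base_vector h + z h"
      and z: "\<And>v h. \<lbrakk>v \<in> W; h \<in> carrier G\<rbrakk> \<Longrightarrow> (\<Sum>g\<in>carrier G. v g * z (inv g \<otimes> h)) = 0"
      by blast
    have "v \<in> U" if v: "v \<in> W" for v
    proof -
      have vV: "v \<in> rep_space ind"
        using v W(1) by blast
      \<comment> \<open>Convolving \<open>v\<close> with \<open>F\<close> kills the \<open>z\<close>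
        part and reproduces \<open>v\<close> up to the factor \<open>m * card K\<close>; this
        exhibits \<open>v\<close> as a combination of translates of \<open>F\<close>.\<close>
      have "v = fscale (1 / (m * of_nat (card K))) (\<Sum>g\<in>carrier G. fscale (v g) (rep_act ind g F))"
      proof
        fix h
        show "v h = fscale (1 / (m * of_nat (card K)))
          (\<Sum>g\<in>carrier G. fscale (v g) (rep_act ind g F)) h"
        proof (cases "h \<in> carrier G")
          case True
          have "(\<Sum>g\<in>carrier G. v g * F (inv g \<otimes> h)) =
              (\<Sum>g\<in>carrier G. m * (v g * base_vector (inv g \<otimes> h)) + v g * z (inv g \<otimes> h))"
            using True by (intro sum.cong) (auto simp: Fz algebra_simps)
          also have "\<dots> = m * (of_nat (card K) * v h)"
            using z[OF v True] convolution_base_vector[OF vV True]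
            by (simp add: sum.distrib sum_distrib_left[symmetric])
          finally show ?thesis
            using True m card_K by (simp add: sum_cfun_apply act_ind)
        next
          case False
          then show ?thesis
            using vV by (simp add: sum_cfun_apply act_ind mem_ind_iff)
        qed
      qed
      also have "\<dots> \<in> U"
        using FU U(3) by (intro cfun.subspace_scale cfun.subspace_sum U(1)) blast
      finally show ?thesis .
    qed
    then show ?thesis
      using U(2) by blast
  qed
  then show ?thesis
    using W(2) unfolding irreducible_representation_def by (auto simp: image_subset_iff)
qed

end

section \<open>The group \<open>GL(2, F)\<close> and its Borel subgroup\<close>

lemma ring_of_type_algebra_simps [simp]:
  "carrier ring_of_type_algebra = UNIV" "x \<otimes>\<^bsub>ring_of_type_algebra\<^esub> y = x * y"
  "\<one>\<^bsub>ring_of_type_algebra\<^esub> = 1" "\<zero>\<^bsub>ring_of_type_algebra\<^esub> = 0"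
  by (simp_all add: ring_of_type_algebra_def)

lemma group_Fstar: "group (Fstar :: 'a::{field,finite} monoid)"
proof (rule groupI)
  fix x :: 'a assume "x \<in> carrier Fstar"
  then show "\<exists>y\<in>carrier Fstar. y \<otimes>\<^bsub>Fstar\<^esub> x = \<one>\<^bsub>Fstar\<^esub>"
    by (intro bexI[of _ "inverse x"]) auto
qed auto

lemma characterD:
  assumes "\<psi> \<in> characters A"
  shows character_mult: "\<lbrakk>x \<in> carrier A; y \<in> carrier A\<rbrakk> \<Longrightarrow> \<psi> (x \<otimes>\<^bsub>A\<^esub> y) = \<psi> x * \<psi> y"
    and character_norm: "x \<in> carrier A \<Longrightarrow> cmod (\<psi> x) = 1"
  using assms by (auto simp: characters_def hom_def circle_group_def)

lemma Fstar_characterD: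
  fixes \<psi> :: "'a::{field,finite} \<Rightarrow> complex"
  assumes "\<psi> \<in> characters Fstar"
  shows Fstar_character_mult: "\<lbrakk>x \<noteq> 0; y \<noteq> 0\<rbrakk> \<Longrightarrow> \<psi> (x * y) = \<psi> x * \<psi> y"
    and Fstar_character_norm: "x \<noteq> 0 \<Longrightarrow> cmod (\<psi> x) = 1"
  using characterD[OF assms] by auto

text \<open>Otherwise the characteristic is 2, and it divides the order of the field.\<close>

lemma minus_one_neq_one:
  assumes "odd CARD('a::{field,finite})"
  shows "(- 1 :: 'a) \<noteq> 1"
proof
  assume "(- 1 :: 'a) = 1"
  then have "(1 :: 'a) + 1 = 0"
    by (metis add.right_inverse)
  then have "of_nat 2 = (0 :: 'a)"
    by simp
  then have "CHAR('a) dvd 2"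
    by (simp only: of_nat_eq_0_iff_char_dvd)
  then have "CHAR('a) = 2"
    using CHAR_not_1' primes_dvd_imp_eq two_is_prime_nat prime_nat_iff by auto
  then show False
    using assms CHAR_dvd_CARD[where ?'a = 'a] by simp
qed

text \<open>If \<eta> were a square, so would be everything it generates. Squaring would then be
  onto the nonzero elements, hence injective by finiteness, although 1 and -1 have the same
  square.\<close>

lemma generator_not_square:
  fixes \<eta> :: "'a::{field,finite}"
  assumes "odd CARD('a)" "field_generator \<eta>"
  shows "s\<^sup>2 \<noteq> \<eta>"
proof
  assume s: "s\<^sup>2 = \<eta>"
  interpret Fstar: group "Fstar :: 'a monoid" by (rule group_Fstar)
  have s0: "s \<noteq> 0"
    using s assms(2) unfolding field_generator_def by fastforce
  have sq: "\<exists>t. t \<noteq> 0 \<and> t\<^sup>2 = x" if "x \<in> generate Fstar {\<eta>}" for x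
    using that
  proof induction
    case one
    show ?case by (intro exI[of _ 1]) simp
  next
    case (incl h)
    then show ?case
      using s s0 by auto
  next
    case (inv h)
    then have "h = s\<^sup>2"
      using s by simp
    moreover have "inv\<^bsub>Fstar\<^esub> (s\<^sup>2) = (inverse s)\<^sup>2"
      using s0 by (intro Fstar.inv_equality) (auto simp: power_mult_distrib[symmetric])
    ultimately show ?case
      using s0 by (intro exI[of _ "inverse s"]) simp
  next
    case (eng h1 h2)
    then obtain t1 t2 where "t1 \<noteq> 0" "t2 \<noteq> 0" "t1\<^sup>2 = h1" "t2\<^sup>2 = h2"
      by blast
    then show ?case
      by (intro exI[of _ "t1 * t2"]) (auto simp: power_mult_distrib)
  qed
  have surj: "(\<lambda>t. t\<^sup>2) ` (UNIV - {0 :: 'a}) = UNIV - {0}"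
  proof (intro equalityI subsetI)
    fix x :: 'a assume "x \<in> UNIV - {0}"
    then have "x \<in> generate Fstar {\<eta>}"
      using assms(2) by (simp add: field_generator_def)
    then show "x \<in> (\<lambda>t. t\<^sup>2) ` (UNIV - {0})"
      using sq by blast
  qed auto
  then have "inj_on (\<lambda>t. t\<^sup>2) (UNIV - {0 :: 'a})"
    by (intro eq_card_imp_inj_on) auto
  then have "(- 1 :: 'a) = 1"
    by (rule inj_onD) auto
  then show False
    using minus_one_neq_one[OF assms(1)] by simp
qed

section \<open>Two-by-two matrices, the Borel subgroup and its cosets\<close>

lemma mat2_nth [simp]:
  "mat2 a b c d $ 1 $ 1 = a" "mat2 a b c d $ 1 $ 2 = b"
  "mat2 a b c d $ 2 $ 1 = c" "mat2 a b c d $ 2 $ 2 = d"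
  by (simp_all add: mat2_def)

lemma mat2_eq_iff: "A = mat2 a b c d \<longleftrightarrow> A $ 1 $ 1 = a \<and> A $ 1 $ 2 = b \<and> A $ 2 $ 1 = c \<and> A $ 2 $ 2 = d"
  by (auto simp: vec_eq_iff forall_2)

lemma mat2_mult [simp]:
  "mat2 a b c d ** mat2 a' b' c' d' =
   mat2 (a * a' + b * c') (a * b' + b * d') (c * a' + d * c') (c * b' + d * d')"
  by (simp add: mat2_eq_iff matrix_matrix_mult_def sum_2)

lemma matrix_mult_nth_2:
  fixes A B :: "'a::comm_ring_1^2^2"
  shows "(A ** B) $ i $ j = A $ i $ 1 * B $ 1 $ j + A $ i $ 2 * B $ 2 $ j"
  by (simp add: matrix_matrix_mult_def sum_2)

lemma det_mat2 [simp]: "det (mat2 a b c d) = a * d - b * c"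
  by (simp add: det_2)

lemma mat2_one: "mat 1 = mat2 1 0 0 1"
  by (simp add: mat2_eq_iff mat_def)

lemma GL2_simps [simp]:
  "g \<in> carrier GL2 \<longleftrightarrow> det g \<noteq> 0" "g \<otimes>\<^bsub>GL2\<^esub> h = g ** h" "\<one>\<^bsub>GL2\<^esub> = mat2 1 0 0 1"
  by (simp_all add: GL2_def invertible_det_nz mat2_one)

lemma finite_GL2: "finite (carrier (GL2 :: ('a::{field,finite}^2^2) monoid))"
  by simp

lemma group_GL2: "group (GL2 :: ('a::{field,finite}^2^2) monoid)"
proof (rule groupI)
  fix g :: "'a^2^2" assume "g \<in> carrier GL2"
  then obtain h where h: "h ** g = mat 1"
    by (auto simp: GL2_def invertible_def)
  then have "det h * det g = 1"
    by (metis det_I det_mul)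
  then show "\<exists>h\<in>carrier GL2. h \<otimes>\<^bsub>GL2\<^esub> g = \<one>\<^bsub>GL2\<^esub>"
    using h by (intro bexI[of _ h]) (auto simp: mat2_one)
qed (auto simp: det_mul matrix_mul_assoc mat2_one[symmetric])

interpretation GL2: group "GL2 :: ('a::{field,finite}^2^2) monoid"
  by (rule group_GL2)

lemma det_inv_GL2:
  assumes "det g \<noteq> 0"
  shows "det (inv\<^bsub>GL2\<^esub> g) = inverse (det g)"
proof -
  have "det (inv\<^bsub>GL2\<^esub> g) * det g = det (inv\<^bsub>GL2\<^esub> g ** g)"
    by (simp add: det_mul)
  also have "\<dots> = 1"
    using GL2.l_inv[of g] assms by simp
  finally show ?thesis
    using assms by (simp add: field_simps)
qed

lemma borel_subgroup_iff: "g \<in> borel_subgroup \<longleftrightarrow> g $ 2 $ 1 = 0 \<and> g $ 1 $ 1 \<noteq> 0 \<and> g $ 2 $ 2 \<noteq> 0"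
  by (auto simp: borel_subgroup_def det_2)

lemma subgroup_borel: "subgroup (borel_subgroup :: ('a::{field,finite}^2^2) set) GL2"
proof (rule GL2.subgroupI)
  fix g :: "'a^2^2" assume g: "g \<in> borel_subgroup"
  let ?h = "mat2 (1 / g$1$1) (- g$1$2 / (g$1$1 * g$2$2)) 0 (1 / g$2$2)"
  have g': "g = mat2 (g$1$1) (g$1$2) 0 (g$2$2)" and nz: "g$1$1 \<noteq> 0" "g$2$2 \<noteq> 0"
    using g by (simp_all add: mat2_eq_iff borel_subgroup_iff)
  have "?h ** mat2 (g$1$1) (g$1$2) 0 (g$2$2) = mat2 1 0 0 1"
    using nz by (simp add: mat2_eq_iff)
  then have "?h \<otimes>\<^bsub>GL2\<^esub> g = \<one>\<^bsub>GL2\<^esub>"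
    using g' by simp
  then have "inv\<^bsub>GL2\<^esub> g = ?h"
    using nz g by (intro GL2.inv_equality) (auto simp: borel_subgroup_def)
  then show "inv\<^bsub>GL2\<^esub> g \<in> borel_subgroup"
    using nz by (simp add: borel_subgroup_iff)
next
  fix g h :: "'a^2^2" assume "g \<in> borel_subgroup" "h \<in> borel_subgroup"
  then show "g \<otimes>\<^bsub>GL2\<^esub> h \<in> borel_subgroup"
    by (simp add: borel_subgroup_iff matrix_mult_nth_2)
next
  have "mat2 1 0 0 1 \<in> borel_subgroup"
    by (simp add: borel_subgroup_iff)
  then show "(borel_subgroup :: ('a^2^2) set) \<noteq> {}"
    by blast
qed (auto simp: borel_subgroup_def)

lemma finite_group_character_borel:
  fixes \<psi>1 \<psi>2 :: "'a::{field,finite} \<Rightarrow> complex"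
  assumes "\<psi>1 \<in> characters Fstar" "\<psi>2 \<in> characters Fstar"
  shows "finite_group_character GL2 borel_subgroup (borel_char \<psi>1 \<psi>2)"
proof (intro finite_group_character.intro finite_group_character_axioms.intro
    group_GL2 finite_GL2 subgroup_borel)
  fix k l :: "'a^2^2" assume "k \<in> borel_subgroup" "l \<in> borel_subgroup"
  then show "borel_char \<psi>1 \<psi>2 (k \<otimes>\<^bsub>GL2\<^esub> l) = borel_char \<psi>1 \<psi>2 k * borel_char \<psi>1 \<psi>2 l"
    using assms
    by (simp add: borel_char_def borel_subgroup_iff matrix_mult_nth_2 Fstar_character_mult)
next
  fix k :: "'a^2^2" assume "k \<in> borel_subgroup"
  then show "cmod (borel_char \<psi>1 \<psi>2 k) = 1"
    using assms by (simp add: borel_char_def borel_subgroup_iff norm_mult Fstar_character_norm)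
qed

text \<open>The cosets of \<open>B\<close> are the points of the projective line, a coset being
  given by the first column up to scaling. The identity represents the point at infinity and
  \<open>mat2 \<gamma> \<eta> 1 \<gamma>\<close>, the Cartan element \<open>\<gamma> + i\<close>,
  represents the point \<gamma>.\<close>

lemma sum_GL2_borel:
  fixes \<eta> :: "'a::{field,finite}" and f :: "'a^2^2 \<Rightarrow> complex"
  assumes \<eta>: "\<And>c::'a. c\<^sup>2 \<noteq> \<eta>"
    and f: "\<And>g b. \<lbrakk>det g \<noteq> 0; b \<in> borel_subgroup\<rbrakk> \<Longrightarrow> f (g ** b) = f g"
  shows "(\<Sum>g\<in>carrier GL2. f g) =
    of_nat (card (borel_subgroup :: ('a^2^2) set)) * (f (mat2 1 0 0 1) + (\<Sum>\<gamma>\<in>UNIV. f (mat2 \<gamma> \<eta> 1 \<gamma>)))"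
proof -
  let ?B = "borel_subgroup :: ('a^2^2) set"
  have nz: "\<gamma> * \<gamma> - \<eta> \<noteq> 0" for \<gamma>
    using \<eta>[of \<gamma>] by (simp add: power2_eq_square)
  let ?p = "\<lambda>(\<gamma>, b). mat2 \<gamma> \<eta> 1 \<gamma> ** b"
  have "inj_on ?p (UNIV \<times> ?B)"
  proof (rule inj_onI, clarify)
    fix \<gamma> \<gamma>' and b b' :: "'a^2^2"
    assume b: "b \<in> ?B" "b' \<in> ?B" and eq: "mat2 \<gamma> \<eta> 1 \<gamma> ** b = mat2 \<gamma>' \<eta> 1 \<gamma>' ** b'"
    have "\<gamma> * b $ 1 $ 1 = \<gamma>' * b' $ 1 $ 1" "b $ 1 $ 1 = b' $ 1 $ 1"
      using arg_cong[OF eq, of "\<lambda>m::'a^2^2. m $ 1 $ 1"] arg_cong[OF eq, of "\<lambda>m::'a^2^2. m $ 2 $ 1"] b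
      by (simp_all add: matrix_mult_nth_2 borel_subgroup_iff)
    then have \<gamma>: "\<gamma> = \<gamma>'"
      using b by (simp add: borel_subgroup_iff)
    then show "\<gamma> = \<gamma>' \<and> b = b'"
      using eq b nz[of \<gamma>] GL2.l_cancel[of "mat2 \<gamma> \<eta> 1 \<gamma>" b b'] by (simp add: borel_subgroup_def)
  qed
  moreover have "?p ` (UNIV \<times> ?B) = carrier GL2 - ?B"
  proof (intro equalityI subsetI)
    fix g assume "g \<in> ?p ` (UNIV \<times> ?B)"
    then obtain \<gamma> b where g: "g = mat2 \<gamma> \<eta> 1 \<gamma> ** b" and b: "b \<in> ?B" by auto
    then have "g $ 2 $ 1 \<noteq> 0" "det g \<noteq> 0"
      using nz[of \<gamma>] by (simp_all add: matrix_mult_nth_2 borel_subgroup_iff det_mul det_2[of b])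
    then show "g \<in> carrier GL2 - ?B"
      by (simp add: borel_subgroup_iff)
  next
    fix g assume g: "g \<in> carrier GL2 - ?B"
    \<comment> \<open>Right multiplication by \<open>B\<close> only scales the first column, so the
      ratio of its entries determines the coset.\<close>
    define \<gamma> where "\<gamma> = g $ 1 $ 1 / g $ 2 $ 1"
    define b where "b = inv\<^bsub>GL2\<^esub> (mat2 \<gamma> \<eta> 1 \<gamma>) ** g"
    have gb: "g = mat2 \<gamma> \<eta> 1 \<gamma> ** b" and "det b \<noteq> 0"
      using g nz[of \<gamma>] GL2.inv_solve_left'[of b "mat2 \<gamma> \<eta> 1 \<gamma>" g]
        GL2.m_closed[of "inv\<^bsub>GL2\<^esub> (mat2 \<gamma> \<eta> 1 \<gamma>)" g] GL2.inv_closed[of "mat2 \<gamma> \<eta> 1 \<gamma>"]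
      by (auto simp: b_def)
    have c: "g $ 2 $ 1 \<noteq> 0"
      using g by (auto simp: borel_subgroup_def)
    \<comment> \<open>Comparing first columns leaves
      \<open>(\<gamma>\<^sup>2 - \<eta>) b\<^sub>2\<^sub>1 = 0\<close>, and the first factor is
      nonzero.\<close>
    have "\<gamma> * (b $ 1 $ 1 + \<gamma> * b $ 2 $ 1) = \<gamma> * b $ 1 $ 1 + \<eta> * b $ 2 $ 1"
    proof -
      have "g $ 1 $ 1 = \<gamma> * g $ 2 $ 1"
        using c by (simp add: \<gamma>_def)
      then show ?thesis
        unfolding gb by (simp add: matrix_mult_nth_2)
    qed
    then have "(\<gamma> * \<gamma> - \<eta>) * b $ 2 $ 1 = 0"
      by (simp add: algebra_simps)
    then have "b \<in> ?B"
      using nz[of \<gamma>] \<open>det b \<noteq> 0\<close> by (simp add: borel_subgroup_def)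
    then show "g \<in> ?p ` (UNIV \<times> ?B)"
      using gb by auto
  qed
  ultimately have "bij_betw ?p (UNIV \<times> ?B) (carrier GL2 - ?B)"
    by (simp add: bij_betw_def)
  then have "(\<Sum>g\<in>carrier GL2 - ?B. f g) = (\<Sum>(\<gamma>, b)\<in>UNIV \<times> ?B. f (mat2 \<gamma> \<eta> 1 \<gamma> ** b))"
    by (simp add: sum.reindex_bij_betw[symmetric] case_prod_unfold)
  also have "\<dots> = (\<Sum>(\<gamma>, b)\<in>UNIV \<times> ?B. f (mat2 \<gamma> \<eta> 1 \<gamma>))"
    using nz by (intro sum.cong) (auto intro!: f)
  also have "\<dots> = of_nat (card ?B) * (\<Sum>\<gamma>\<in>UNIV. f (mat2 \<gamma> \<eta> 1 \<gamma>))"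
    by (simp add: sum.cartesian_product[symmetric] sum_distrib_left)
  finally have "(\<Sum>g\<in>carrier GL2 - ?B. f g) = of_nat (card ?B) * (\<Sum>\<gamma>\<in>UNIV. f (mat2 \<gamma> \<eta> 1 \<gamma>))" .
  moreover have "f b = f (mat2 1 0 0 1)" if "b \<in> ?B" for b
    using f[of "mat2 1 0 0 1" b] that by (simp add: mat2_one[symmetric])
  then have "(\<Sum>g\<in>?B. f g) = of_nat (card ?B) * f (mat2 1 0 0 1)"
    by simp
  moreover have "?B \<subseteq> carrier GL2"
    by (auto simp: borel_subgroup_def)
  ultimately show ?thesis
    using sum.subset_diff[of ?B "carrier GL2" f, OF _ finite_GL2] by (simp add: algebra_simps)
qed

section \<open>Inverses and quotients under a multiplicative character\<close>

context
  fixes \<psi> :: "'a::{field,finite} \<Rightarrow> complex"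
  assumes \<psi>: "\<psi> \<in> characters Fstar"
begin

lemma Fstar_character_cnj: "x \<noteq> 0 \<Longrightarrow> \<psi> x * cnj (\<psi> x) = 1" "x \<noteq> 0 \<Longrightarrow> cnj (\<psi> x) * \<psi> x = 1"
  using Fstar_character_norm[OF \<psi>] complex_norm_square[of "\<psi> x"] by (auto simp: mult.commute)

lemma Fstar_character_one: "\<psi> 1 = 1"
proof -
  have "\<psi> 1 * \<psi> 1 = \<psi> 1" "\<psi> 1 \<noteq> 0"
    using Fstar_character_mult[OF \<psi>, of 1 1] Fstar_character_norm[OF \<psi>, of 1] by auto
  then show ?thesis by simp
qed

lemma Fstar_character_inverse: "x \<noteq> 0 \<Longrightarrow> \<psi> (inverse x) = cnj (\<psi> x)"
proof -
  assume x: "x \<noteq> 0"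
  have "\<psi> (inverse x) * \<psi> x = 1"
    using Fstar_character_mult[OF \<psi>, of "inverse x" x] x Fstar_character_one by simp
  then have "\<psi> (inverse x) * (\<psi> x * cnj (\<psi> x)) = cnj (\<psi> x)"
    by (simp add: mult.assoc[symmetric])
  then show ?thesis
    using Fstar_character_cnj[OF x] by simp
qed

lemma Fstar_character_divide: "\<lbrakk>x \<noteq> 0; y \<noteq> 0\<rbrakk> \<Longrightarrow> \<psi> (x / y) = \<psi> x * cnj (\<psi> y)"
  using Fstar_character_mult[OF \<psi>, of x "inverse y"] by (simp add: field_class.field_divide_inverse Fstar_character_inverse)

end

section \<open>Irreducibility of the parabolic representations\<close>

locale principal_series =
  fixes \<psi>1 \<psi>2 :: "'a::{field,finite} \<Rightarrow> complex"
  assumes \<psi>1: "\<psi>1 \<in> characters Fstar" and \<psi>2: "\<psi>2 \<in> characters Fstar"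
begin

sublocale B: finite_group_character GL2 borel_subgroup "borel_char \<psi>1 \<psi>2"
  using \<psi>1 \<psi>2 by (rule finite_group_character_borel)

lemma mult_borel_right:
  "\<lbrakk>f \<in> rep_space B.ind; det g \<noteq> 0; b \<in> borel_subgroup\<rbrakk> \<Longrightarrow> f (g ** b) = cnj (borel_char \<psi>1 \<psi>2 b) * f g"
  by (simp add: B.mem_ind_iff)

lemma mult_borel_left:
  assumes F: "\<And>k. k \<in> borel_subgroup \<Longrightarrow> rep_act B.ind k F = fscale (borel_char \<psi>1 \<psi>2 k) F"
    and k: "k \<in> borel_subgroup" and g: "det g \<noteq> 0"
  shows "F (k ** g) = cnj (borel_char \<psi>1 \<psi>2 k) * F g"
proof -
  have "rep_act B.ind (inv\<^bsub>GL2\<^esub> k) F g = F (k ** g)"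
    using g B.K_subset[OF k] by (simp add: B.act_ind)
  then show ?thesis
    using F[OF B.K_closed(2)[OF k]] B.char_inv[OF k] by simp
qed

text \<open>In the Bruhat factorization \<open>g = n s b\<close> the left factor \<open>n\<close> is
  unipotent, so the character is trivial on it. Equivariance on both sides then reduces
  \<open>F\<close> on the big cell to its value at the Weyl element \<open>s\<close>.\<close>

lemma borel_eigenvector_big_cell:
  fixes g :: "'a^2^2"
  assumes FV: "F \<in> rep_space B.ind"
    and F: "\<And>k. k \<in> borel_subgroup \<Longrightarrow> rep_act B.ind k F = fscale (borel_char \<psi>1 \<psi>2 k) F"
    and g: "det g \<noteq> 0" "g $ 2 $ 1 \<noteq> 0"
  shows "F g = cnj (\<psi>1 (g $ 2 $ 1) * \<psi>2 (- det g / g $ 2 $ 1)) * F (mat2 0 1 1 0)"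
proof -
  let ?n = "mat2 1 (g $ 1 $ 1 / g $ 2 $ 1) 0 1" and ?s = "mat2 0 1 1 0 :: 'a^2^2"
  let ?b = "mat2 (g $ 2 $ 1) (g $ 2 $ 2) 0 (- det g / g $ 2 $ 1)"
  have "g = ?n ** (?s ** ?b)"
    using g by (simp add: mat2_eq_iff det_2 field_simps)
  moreover have "F (?n ** (?s ** ?b)) = cnj (borel_char \<psi>1 \<psi>2 ?n) * F (?s ** ?b)"
    using g by (intro mult_borel_left F) (simp_all add: borel_subgroup_iff)
  moreover have "F (?s ** ?b) = cnj (borel_char \<psi>1 \<psi>2 ?b) * F ?s"
    using g by (intro mult_borel_right FV) (simp_all add: borel_subgroup_iff)
  ultimately show ?thesis
    by (simp add: borel_char_def Fstar_character_one \<psi>1 \<psi>2)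
qed

lemma borel_vector_on_borel:
  assumes "F \<in> rep_space B.ind" "b \<in> borel_subgroup"
  shows "F b = cnj (borel_char \<psi>1 \<psi>2 b) * F (mat2 1 0 0 1)"
  using mult_borel_right[of F "mat2 1 0 0 1" b] assms by (simp add: mat2_one[symmetric])

lemma irreducible_parabolic:
  assumes "\<psi>1 \<noteq> \<psi>2" "rep_space B.ind \<noteq> {0}"
  shows "irreducible_representation GL2 B.ind"
proof -
  \<comment> \<open>Characters are extensional, so distinct ones already differ at some nonzero
    argument.\<close>
  obtain t where t: "t \<noteq> 0" "\<psi>1 t \<noteq> \<psi>2 t"
    using assms(1) \<psi>1 \<psi>2 unfolding characters_def by (auto simp: extensional_def fun_eq_iff) metis
  have "irreducible_representation GL2 (B.ind\<lparr>rep_space := rep_space B.ind\<rparr>)"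
  proof (rule B.irreducible_subrepresentation)
    fix F assume FV: "F \<in> rep_space B.ind" and F1: "F \<one>\<^bsub>GL2\<^esub> \<noteq> 0"
      and F: "\<And>k. k \<in> borel_subgroup \<Longrightarrow> rep_act B.ind k F = fscale (borel_char \<psi>1 \<psi>2 k) F"
    let ?s = "mat2 0 1 1 0 :: 'a^2^2"
    \<comment> \<open>The Weyl element swaps the two diagonal entries, so
      \<open>diag(t,1) s = s diag(1,t)\<close>. Evaluating \<open>F\<close> both ways with
      \<open>\<psi>1 t \<noteq> \<psi>2 t\<close> forces \<open>F\<close> to vanish on the big
      cell.\<close>
    have "F (mat2 t 0 0 1 ** ?s) = cnj (borel_char \<psi>1 \<psi>2 (mat2 t 0 0 1)) * F ?s"
      using t by (intro mult_borel_left F) (simp_all add: borel_subgroup_iff)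
    moreover have "F (?s ** mat2 1 0 0 t) = cnj (borel_char \<psi>1 \<psi>2 (mat2 1 0 0 t)) * F ?s"
      using t by (intro mult_borel_right FV) (simp_all add: borel_subgroup_iff)
    ultimately have "cnj (\<psi>1 t) * F ?s = cnj (\<psi>2 t) * F ?s"
      by (simp add: borel_char_def Fstar_character_one \<psi>1 \<psi>2)
    then have s: "F ?s = 0"
      using t by simp
    have "F h = F \<one>\<^bsub>GL2\<^esub> * B.base_vector h + 0" if h: "h \<in> carrier GL2" for h
    proof (cases "h \<in> borel_subgroup")
      case True
      then show ?thesis
        using borel_vector_on_borel[OF FV True] by (simp add: B.base_vector_def)
    next
      case False
      then have "h $ 2 $ 1 \<noteq> 0"
        using h by (simp add: borel_subgroup_def)
      then show ?thesis
        using False h borel_eigenvector_big_cell[OF FV F, of h] s by (simp add: B.base_vector_def)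
    qed
    moreover have "(\<Sum>g\<in>carrier GL2. v g * 0) = 0" for v :: "'a^2^2 \<Rightarrow> complex"
      by simp
    ultimately show "\<exists>m z. m \<noteq> 0 \<and> (\<forall>h\<in>carrier GL2. F h = m * B.base_vector h + z h) \<and>
        (\<forall>v\<in>rep_space B.ind. \<forall>h\<in>carrier GL2.
          (\<Sum>g\<in>carrier GL2. v g * z (inv\<^bsub>GL2\<^esub> g \<otimes>\<^bsub>GL2\<^esub> h)) = 0)"
      using F1 by (intro exI[of _ "F \<one>\<^bsub>GL2\<^esub>"] exI[of _ "\<lambda>_. 0"]) blast
  qed (use assms in auto)
  then show ?thesis by simp
qed

end

section \<open>Equal characters: the complement of the determinant character\<close>

context
  fixes \<psi> :: "'a::{field,finite} \<Rightarrow> complex"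
  assumes \<psi>: "\<psi> \<in> characters Fstar"
begin

interpretation principal_series \<psi> \<psi>
  using \<psi> by unfold_locales

lemma borel_char_det: "b \<in> borel_subgroup \<Longrightarrow> borel_char \<psi> \<psi> b = \<psi> (det b)"
  by (simp add: borel_char_def borel_subgroup_iff det_2 Fstar_character_mult[OF \<psi>])

text \<open>Evaluating the eigenvalue equation for \<open>g\<close> at the point \<open>g\<close>
  expresses \<open>f g\<close> through the value at the identity, so this summand is a line. The
  conjugate comes from the inverse in left translation.\<close>

lemma parabolic_rep0_space:
  "rep_space (parabolic_rep0 \<psi>) = range (\<lambda>c g. if det g = 0 then 0 else c * cnj (\<psi> (det g)))"
proof (intro equalityI subsetI)
  fix f assume "f \<in> rep_space (parabolic_rep0 \<psi>)"
  then have fV: "f \<in> rep_space B.ind" and f: "\<And>g. det g \<noteq> 0 \<Longrightarrow> rep_act B.ind g f = fscale (\<psi> (det g)) f"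
    by (auto simp: parabolic_rep0_def parabolic_rep_def Let_def)
  have "f g = (if det g = 0 then 0 else f (mat2 1 0 0 1) * cnj (\<psi> (det g)))" for g
  proof (cases "det g = 0")
    case True
    then show ?thesis using fV by (simp add: B.mem_ind_iff)
  next
    case False
    then have "rep_act B.ind g f g = f (mat2 1 0 0 1)"
      using GL2.l_inv[of g] by (simp add: B.act_ind)
    then have "\<psi> (det g) * f g = f (mat2 1 0 0 1)"
      using f[OF False] by simp
    then have "(cnj (\<psi> (det g)) * \<psi> (det g)) * f g = f (mat2 1 0 0 1) * cnj (\<psi> (det g))"
      by (simp add: mult.assoc)
    then show ?thesis
      using False Fstar_character_cnj[OF \<psi> False] by simp
  qed
  then have "f = (\<lambda>g. if det g = 0 then 0 else f (mat2 1 0 0 1) * cnj (\<psi> (det g)))"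
    by (rule ext)
  then show "f \<in> range (\<lambda>c g. if det g = 0 then 0 else c * cnj (\<psi> (det g)))"
    by (rule range_eqI)
next
  fix f :: "'a^2^2 \<Rightarrow> complex"
  assume "f \<in> range (\<lambda>c g. if det g = 0 then 0 else c * cnj (\<psi> (det g)))"
  then obtain c where f: "f = (\<lambda>g. if det g = 0 then 0 else c * cnj (\<psi> (det g)))" by blast
  have "f \<in> rep_space B.ind"
    using B.K_subset
    by (auto simp: f B.mem_ind_iff det_mul Fstar_character_mult[OF \<psi>] borel_char_det)
  moreover have "rep_act B.ind g f = fscale (\<psi> (det g)) f" if "det g \<noteq> 0" for g
    using that Fstar_character_inverse[OF \<psi>]
    by (auto simp: f B.act_ind fun_eq_iff det_mul det_inv_GL2 Fstar_character_mult[OF \<psi>])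
  ultimately show "f \<in> rep_space (parabolic_rep0 \<psi>)"
    by (auto simp: parabolic_rep0_def parabolic_rep_def Let_def)
qed

text \<open>Orthogonality to a line is one linear equation, a form that can be checked by reindexing
  sums over the group.\<close>

lemma parabolic_rep1_eq: "parabolic_rep1 \<psi> =
    B.ind\<lparr>rep_space := {f \<in> rep_space B.ind. (\<Sum>g\<in>carrier GL2. f g * \<psi> (det g)) = 0}\<rparr>"
proof -
  have "(\<forall>h\<in>rep_space (parabolic_rep0 \<psi>). rep_inner B.ind f h = 0) \<longleftrightarrow>
      (\<Sum>g\<in>carrier GL2. f g * \<psi> (det g)) = 0" for f
  proof -
    have "rep_inner B.ind f (\<lambda>g. if det g = 0 then 0 else c * cnj (\<psi> (det g))) =
        cnj c * (\<Sum>g\<in>carrier GL2. f g * \<psi> (det g)) / of_nat (card (borel_subgroup :: ('a^2^2) set))" for c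
      unfolding B.inner_ind sum_distrib_left
      by (intro arg_cong2[where f = "(/)"] sum.cong) auto
    then show ?thesis
      using B.card_K unfolding parabolic_rep0_space by (auto simp: image_iff)
  qed
  then show ?thesis
    by (simp add: parabolic_rep1_def parabolic_rep_def Let_def)
qed

lemma subspace_parabolic_rep1: "cfun.subspace (rep_space (parabolic_rep1 \<psi>))"
  using unitary_subspace[OF B.unitary_ind]
  by (auto simp: parabolic_rep1_eq cfun.subspace_def distrib_right sum.distrib mult.assoc
      sum_distrib_left[symmetric])

text \<open>Substituting \<open>a g\<close> for \<open>g\<close> multiplies the defining sum by
  \<open>\<psi> (det a)\<close>, so its vanishing persists.\<close>

lemma parabolic_rep1_invariant:
  assumes a: "a \<in> carrier GL2" and f: "f \<in> rep_space (parabolic_rep1 \<psi>)"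
  shows "rep_act B.ind a f \<in> rep_space (parabolic_rep1 \<psi>)"
proof -
  have f0: "(\<Sum>g\<in>carrier GL2. f g * \<psi> (det g)) = 0" and fV: "f \<in> rep_space B.ind"
    using f by (auto simp: parabolic_rep1_eq)
  have inv: "a ** inv\<^bsub>GL2\<^esub> a = mat 1" "inv\<^bsub>GL2\<^esub> a ** a = mat 1"
    using GL2.r_inv[OF a] GL2.l_inv[OF a] by (simp_all add: mat2_one)
  have "(\<Sum>g\<in>carrier GL2. rep_act B.ind a f g * \<psi> (det g)) =
      (\<Sum>g\<in>carrier GL2. \<psi> (det a) * (f g * \<psi> (det g)))"
    using a
    by (intro sum.reindex_bij_witness[of _ "\<lambda>g. a \<otimes>\<^bsub>GL2\<^esub> g" "\<lambda>g. inv\<^bsub>GL2\<^esub> a \<otimes>\<^bsub>GL2\<^esub> g"])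
      (auto simp: B.act_ind matrix_mul_assoc det_mul det_inv_GL2 Fstar_character_mult[OF \<psi>]
        Fstar_character_inverse[OF \<psi>] Fstar_character_cnj[OF \<psi>] mult.assoc[symmetric] inv)
  then have "(\<Sum>g\<in>carrier GL2. rep_act B.ind a f g * \<psi> (det g)) = 0"
    using f0 by (simp only: sum_distrib_left[symmetric]) simp
  then show ?thesis
    using unitary_closed[OF B.unitary_ind a fV] by (simp add: parabolic_rep1_eq)
qed

text \<open>With equal characters the Weyl element gives no constraint, and a Borel eigenvector may
  keep a component along the determinant character. That component is harmless: convolving elements
  of the complement with it gives zero.\<close>

lemma irreducible_parabolic_rep1:
  assumes "rep_space (parabolic_rep1 \<psi>) \<noteq> {0}"
  shows "irreducible_representation GL2 (parabolic_rep1 \<psi>)"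
proof -
  let ?W = "rep_space (parabolic_rep1 \<psi>)"
  have WV: "?W \<subseteq> rep_space B.ind"
    by (auto simp: parabolic_rep1_eq)
  have "irreducible_representation GL2 (B.ind\<lparr>rep_space := ?W\<rparr>)"
  proof (rule B.irreducible_subrepresentation[OF WV assms])
    fix F assume FW: "F \<in> ?W" and F1: "F \<one>\<^bsub>GL2\<^esub> \<noteq> 0"
      and F: "\<And>k. k \<in> borel_subgroup \<Longrightarrow> rep_act B.ind k F = fscale (borel_char \<psi> \<psi> k) F"
    have FV: "F \<in> rep_space B.ind" and F0: "(\<Sum>g\<in>carrier GL2. F g * \<psi> (det g)) = 0"
      using FW by (auto simp: parabolic_rep1_eq)
    \<comment> \<open>\<open>k\<close> is fixed by matching \<open>F\<close> with a multiple of
      \<open>cnj (\<psi> (det h))\<close> on the big cell, whose representative has determinant -1;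
      \<open>m\<close> is the remainder at the identity.\<close>
    define k where "k = cnj (\<psi> (- 1)) * F (mat2 0 1 1 0)"
    define m where "m = F \<one>\<^bsub>GL2\<^esub> - k"
    have cell: "F h = m * B.base_vector h + k * cnj (\<psi> (det h))" if h: "h \<in> carrier GL2" for h
    proof (cases "h \<in> borel_subgroup")
      case True
      then show ?thesis
        using borel_vector_on_borel[OF FV True]
        by (simp add: B.base_vector_def m_def borel_char_det algebra_simps)
    next
      case False
      then have c: "det h \<noteq> 0" "h $ 2 $ 1 \<noteq> 0"
        using h by (auto simp: borel_subgroup_def)
      have "\<psi> (h $ 2 $ 1) * \<psi> (- det h / h $ 2 $ 1) = \<psi> (- 1 * det h)"
        using c by (subst Fstar_character_mult[OF \<psi>, symmetric]) auto
      also have "\<dots> = \<psi> (- 1) * \<psi> (det h)"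
        using c by (intro Fstar_character_mult[OF \<psi>]) auto
      finally show ?thesis
        using borel_eigenvector_big_cell[OF FV F c] False
        by (simp add: B.base_vector_def k_def flip: complex_cnj_mult)
    qed
    \<comment> \<open>For \<open>m = 0\<close> the function \<open>F\<close> would lie on the line
      to which it is orthogonal, contradicting its nonzero value at the identity.\<close>
    have "m \<noteq> 0"
    proof
      assume m: "m = 0"
      then have "F g * \<psi> (det g) = k" if "g \<in> carrier GL2" for g
        using that cell[OF that] Fstar_character_cnj[OF \<psi>, of "det g"] by (simp add: mult.assoc)
      then have "(\<Sum>g\<in>carrier GL2. F g * \<psi> (det g)) = of_nat (card (carrier (GL2 :: ('a^2^2) monoid))) * k"
        by simp
      moreover have "carrier (GL2 :: ('a^2^2) monoid) \<noteq> {}"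
        using GL2.one_closed by blast
      ultimately have "k = 0"
        using F0 by simp
      then show False
        using m F1 by (simp add: m_def)
    qed
    \<comment> \<open>The determinant of the inverse of \<open>g\<close> undoes the conjugation, so
      the sum is a multiple of the equation defining the complement.\<close>
    moreover have "(\<Sum>g\<in>carrier GL2. v g * (k * cnj (\<psi> (det (inv\<^bsub>GL2\<^esub> g \<otimes>\<^bsub>GL2\<^esub> h))))) = 0"
      if v: "v \<in> ?W" and h: "h \<in> carrier GL2" for v h
    proof -
      have "(\<Sum>g\<in>carrier GL2. v g * (k * cnj (\<psi> (det (inv\<^bsub>GL2\<^esub> g \<otimes>\<^bsub>GL2\<^esub> h))))) =
          (\<Sum>g\<in>carrier GL2. k * cnj (\<psi> (det h)) * (v g * \<psi> (det g)))"
        using h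
        by (intro sum.cong) (auto simp: det_mul det_inv_GL2 Fstar_character_mult[OF \<psi>] Fstar_character_inverse[OF \<psi>])
      also have "\<dots> = 0"
        using v by (simp add: sum_distrib_left[symmetric] parabolic_rep1_eq)
      finally show ?thesis .
    qed
    ultimately show "\<exists>m z. m \<noteq> 0 \<and> (\<forall>h\<in>carrier GL2. F h = m * B.base_vector h + z h) \<and>
        (\<forall>v\<in>?W. \<forall>h\<in>carrier GL2. (\<Sum>g\<in>carrier GL2. v g * z (inv\<^bsub>GL2\<^esub> g \<otimes>\<^bsub>GL2\<^esub> h)) = 0)"
      using cell by (intro exI[of _ m] exI[of _ "\<lambda>h. k * cnj (\<psi> (det h))"]) blast
  qed
  then show ?thesis
    by (simp add: parabolic_rep1_eq)
qed

end

section \<open>Spherical vectors of the Cartan subgroup\<close>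

locale cartan_character =
  fixes \<eta> :: "'a::{field,finite}" and \<nu> :: "'a \<times> 'a \<Rightarrow> complex"
  assumes not_square: "s\<^sup>2 \<noteq> \<eta>"
    and \<nu>: "\<nu> \<in> characters (Ring_Divisibility.mult_of (quad_ext \<eta>))"
begin

text \<open>The expression is the norm of \<open>a + i b\<close>; a nontrivial zero would make
  \<eta> the square of \<open>a / b\<close>.\<close>

lemma norm_nonzero: "(a, b) \<noteq> (0, 0) \<Longrightarrow> a * a - \<eta> * (b * b) \<noteq> 0"
proof
  assume ab: "(a, b) \<noteq> (0, 0)" and 0: "a * a - \<eta> * (b * b) = 0"
  show False
  proof (cases "b = 0")
    case True
    then show ?thesis using 0 ab by simp
  next
    case False
    then have "(a / b)\<^sup>2 = \<eta>"
      using 0 by (simp add: power2_eq_square field_simps)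
    then show ?thesis
      using not_square by blast
  qed
qed

lemma \<nu>_mult:
  "\<lbrakk>(a, b) \<noteq> (0, 0); (c, d) \<noteq> (0, 0)\<rbrakk> \<Longrightarrow> \<nu> (a * c + \<eta> * (b * d), a * d + b * c) = \<nu> (a, b) * \<nu> (c, d)"
  using character_mult[OF \<nu>, of "(a, b)" "(c, d)"] by (simp add: quad_ext_def)

lemma \<nu>_norm: "(a, b) \<noteq> (0, 0) \<Longrightarrow> cmod (\<nu> (a, b)) = 1"
  using character_norm[OF \<nu>, of "(a, b)"] by (simp add: quad_ext_def)

text \<open>Multiplicativity of the norm transfers nonvanishing to the product.\<close>

lemma cartan_mult_nonzero:
  assumes "(a, b) \<noteq> (0, 0)" "(c, d) \<noteq> (0, 0)"
  shows "(a * c + \<eta> * (b * d), a * d + b * c) \<noteq> (0, 0)"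
proof
  assume "(a * c + \<eta> * (b * d), a * d + b * c) = (0, 0)"
  moreover have "(a * a - \<eta> * (b * b)) * (c * c - \<eta> * (d * d)) =
      (a * c + \<eta> * (b * d)) * (a * c + \<eta> * (b * d)) - \<eta> * ((a * d + b * c) * (a * d + b * c))"
    by (simp add: algebra_simps)
  ultimately have "(a * a - \<eta> * (b * b)) * (c * c - \<eta> * (d * d)) = 0"
    by simp
  then show False
    using norm_nonzero assms by simp
qed

lemma subgroup_cartan: "subgroup (cartan_subgroup \<eta>) GL2"
proof (rule GL2.subgroupI)
  show sub: "cartan_subgroup \<eta> \<subseteq> carrier GL2"
    using norm_nonzero by (auto simp: cartan_subgroup_def mult.assoc)
  have "mat2 1 (\<eta> * 0) 0 1 \<in> cartan_subgroup \<eta>"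
    unfolding cartan_subgroup_def by fastforce
  then show "cartan_subgroup \<eta> \<noteq> {}" by blast
next
  fix g assume "g \<in> cartan_subgroup \<eta>"
  then obtain a b where g: "g = mat2 a (\<eta> * b) b a" and ab: "(a, b) \<noteq> (0, 0)"
    by (auto simp: cartan_subgroup_def)
  \<comment> \<open>The inverse of \<open>a + i b\<close> is its conjugate divided by the norm
    \<open>n\<close>.\<close>
  define n where "n = a * a - \<eta> * (b * b)"
  have n: "n \<noteq> 0"
    using norm_nonzero[OF ab] by (simp add: n_def)
  have "mat2 (a / n) (\<eta> * (- b / n)) (- b / n) (a / n) ** g = mat2 ((a * a - \<eta> * (b * b)) / n) 0 0 ((a * a - \<eta> * (b * b)) / n)"
    by (simp add: g mat2_eq_iff diff_divide_distrib algebra_simps)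
  then have "mat2 (a / n) (\<eta> * (- b / n)) (- b / n) (a / n) \<otimes>\<^bsub>GL2\<^esub> g = \<one>\<^bsub>GL2\<^esub>"
    using n by (simp add: n_def[symmetric])
  moreover have "det (mat2 (a / n) (\<eta> * (- b / n)) (- b / n) (a / n)) = n / (n * n)"
    by (simp add: n_def diff_divide_distrib algebra_simps)
  ultimately have "inv\<^bsub>GL2\<^esub> g = mat2 (a / n) (\<eta> * (- b / n)) (- b / n) (a / n)"
    using n norm_nonzero[OF ab] by (intro GL2.inv_equality) (simp_all add: g mult.assoc)
  moreover have "(a / n, - b / n) \<noteq> (0, 0)"
    using ab n by simp
  ultimately show "inv\<^bsub>GL2\<^esub> g \<in> cartan_subgroup \<eta>"
    unfolding cartan_subgroup_def by blast
next
  fix g h assume "g \<in> cartan_subgroup \<eta>" "h \<in> cartan_subgroup \<eta>"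
  then obtain a b c d where gh: "g = mat2 a (\<eta> * b) b a" "h = mat2 c (\<eta> * d) d c"
    and nz: "(a, b) \<noteq> (0, 0)" "(c, d) \<noteq> (0, 0)"
    by (auto simp: cartan_subgroup_def)
  have "g \<otimes>\<^bsub>GL2\<^esub> h =
      mat2 (a * c + \<eta> * (b * d)) (\<eta> * (a * d + b * c)) (a * d + b * c) (a * c + \<eta> * (b * d))"
    by (simp add: gh mat2_eq_iff algebra_simps)
  then show "g \<otimes>\<^bsub>GL2\<^esub> h \<in> cartan_subgroup \<eta>"
    using cartan_mult_nonzero[OF nz] unfolding cartan_subgroup_def by blast
qed

sublocale C: finite_group_character GL2 "cartan_subgroup \<eta>" "cartan_char \<nu>"
proof (intro finite_group_character.intro finite_group_character_axioms.intro
    group_GL2 finite_GL2 subgroup_cartan)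
  fix g h assume "g \<in> cartan_subgroup \<eta>" "h \<in> cartan_subgroup \<eta>"
  then show "cartan_char \<nu> (g \<otimes>\<^bsub>GL2\<^esub> h) = cartan_char \<nu> g * cartan_char \<nu> h"
    using \<nu>_mult by (auto simp: cartan_subgroup_def cartan_char_def mult.assoc add.commute)
next
  fix g assume "g \<in> cartan_subgroup \<eta>"
  then show "cmod (cartan_char \<nu> g) = 1"
    using \<nu>_norm by (auto simp: cartan_subgroup_def cartan_char_def)
qed

end

section \<open>The Cartan eigenvector inside the space induced from the Borel subgroup\<close>

locale cartan_principal_series = cartan_character \<eta> \<nu> + principal_series \<psi>1 \<psi>2
  for \<eta> :: "'a::{field,finite}" and \<nu> and \<psi>1 \<psi>2 :: "'a \<Rightarrow> complex" +
  assumes central: "t \<noteq> 0 \<Longrightarrow> \<nu> (t, 0) = \<psi>1 t * \<psi>2 t"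
begin

text \<open>
  By \<open>G = C B\<close>, a \<open>\<nu>\<close>-eigenvector of \<open>C\<close> is determined by its value at the identity. The formula
  comes from the factorization of \<open>g\<close>, with first column \<open>(a, b)\<close>, into the element of \<open>C\<close> with
  the same first column and an upper triangular matrix with diagonal
  \<open>(1, det g / (a\<^sup>2 - \<eta> b\<^sup>2))\<close>.
\<close>

definition sph :: "'a^2^2 \<Rightarrow> complex" where
  "sph g = (if det g = 0 then 0 else
     cnj (\<nu> (g $ 1 $ 1, g $ 2 $ 1) *
       \<psi>2 (det g / (g $ 1 $ 1 * g $ 1 $ 1 - \<eta> * (g $ 2 $ 1 * g $ 2 $ 1)))))"

lemma first_column_nonzero:
  fixes g :: "'a^2^2"
  shows "det g \<noteq> 0 \<Longrightarrow> (g $ 1 $ 1, g $ 2 $ 1) \<noteq> (0, 0)"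
  by (auto simp: det_2)

lemma sph_one: "sph (mat2 1 0 0 1) = 1"
  using central[of 1] by (simp add: sph_def Fstar_character_one \<psi>1 \<psi>2)

lemma sph_norm: "det g \<noteq> 0 \<Longrightarrow> sph g * cnj (sph g) = 1"
proof -
  assume g: "det g \<noteq> 0"
  have "cmod (sph g) = 1"
    using g first_column_nonzero[OF g] norm_nonzero[OF first_column_nonzero[OF g]]
    by (simp add: sph_def norm_mult \<nu>_norm Fstar_character_norm[OF \<psi>2])
  then show ?thesis
    using complex_norm_square[of "sph g"] by simp
qed

text \<open>Scaling the first column by \<alpha> contributes
  \<open>\<psi>1 \<alpha> * \<psi>2 \<alpha>\<close> through \<open>central\<close>, and the
  argument of \<psi>2 is multiplied by \<open>\<delta> / \<alpha>\<close>; together these give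
  \<open>\<psi>1 \<alpha> * \<psi>2 \<delta>\<close>.\<close>

lemma sph_mult_borel:
  assumes g: "det g \<noteq> 0" and b: "b \<in> borel_subgroup"
  shows "sph (g ** b) = cnj (borel_char \<psi>1 \<psi>2 b) * sph g"
proof -
  let ?a = "g $ 1 $ 1" and ?c = "g $ 2 $ 1" and ?\<alpha> = "b $ 1 $ 1" and ?\<delta> = "b $ 2 $ 2"
  define N where "N = ?a * ?a - \<eta> * (?c * ?c)"
  have \<alpha>\<delta>: "b $ 2 $ 1 = 0" "?\<alpha> \<noteq> 0" "?\<delta> \<noteq> 0"
    using b by (simp_all add: borel_subgroup_iff)
  have N: "N \<noteq> 0"
    using norm_nonzero[OF first_column_nonzero[OF g]] by (simp add: N_def)
  have "\<nu> (?a * ?\<alpha>, ?c * ?\<alpha>) = \<nu> (?a, ?c) * \<nu> (?\<alpha>, 0)"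
    using \<nu>_mult[OF first_column_nonzero[OF g], of ?\<alpha> 0] \<alpha>\<delta> by simp
  then have 1: "\<nu> (?a * ?\<alpha>, ?c * ?\<alpha>) = \<nu> (?a, ?c) * (\<psi>1 ?\<alpha> * \<psi>2 ?\<alpha>)"
    using central \<alpha>\<delta> by simp
  have "det (g ** b) / (?a * ?\<alpha> * (?a * ?\<alpha>) - \<eta> * (?c * ?\<alpha> * (?c * ?\<alpha>))) =
      (det g * (?\<alpha> * ?\<delta>)) / (?\<alpha> * ?\<alpha> * N)"
    using \<alpha>\<delta> by (simp add: det_mul det_2[of b] N_def algebra_simps)
  also have "\<dots> = (det g / N) * (?\<delta> / ?\<alpha>)"
    using \<alpha>\<delta> by simp
  finally have 2: "\<psi>2 (det (g ** b) / (?a * ?\<alpha> * (?a * ?\<alpha>) - \<eta> * (?c * ?\<alpha> * (?c * ?\<alpha>)))) =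
      \<psi>2 (det g / N) * (\<psi>2 ?\<delta> * cnj (\<psi>2 ?\<alpha>))"
    using g N \<alpha>\<delta> by (simp add: Fstar_character_mult[OF \<psi>2] Fstar_character_divide[OF \<psi>2])
  have "sph (g ** b) = cnj (\<nu> (?a * ?\<alpha>, ?c * ?\<alpha>) *
      \<psi>2 (det (g ** b) / (?a * ?\<alpha> * (?a * ?\<alpha>) - \<eta> * (?c * ?\<alpha> * (?c * ?\<alpha>)))))"
    using g \<alpha>\<delta> by (simp add: sph_def det_mul det_2[of b] matrix_mult_nth_2)
  also have "\<dots> = cnj (\<psi>2 ?\<alpha> * cnj (\<psi>2 ?\<alpha>)) * (cnj (borel_char \<psi>1 \<psi>2 b) * sph g)"
    using g unfolding 1 2 by (simp add: sph_def N_def borel_char_def)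
  finally show ?thesis
    using Fstar_character_cnj[OF \<psi>2 \<alpha>\<delta>(2)] by simp
qed

text \<open>Determinant and norm of the first column are both multiplied by the norm of the Cartan
  element, so the \<psi>2 factor is unchanged and only \<nu> reacts.\<close>

lemma sph_mult_cartan:
  assumes k: "k \<in> cartan_subgroup \<eta>" and g: "det g \<noteq> 0"
  shows "sph (k ** g) = cnj (cartan_char \<nu> k) * sph g"
proof -
  obtain a b where k': "k = mat2 a (\<eta> * b) b a" and ab: "(a, b) \<noteq> (0, 0)"
    using k by (auto simp: cartan_subgroup_def)
  let ?c = "g $ 1 $ 1" and ?d = "g $ 2 $ 1"
  have cd: "(?c, ?d) \<noteq> (0, 0)"
    using g by (rule first_column_nonzero)
  have N: "a * a - \<eta> * (b * b) \<noteq> 0"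
    using norm_nonzero[OF ab] .
  have "(a * ?c + \<eta> * (b * ?d)) * (a * ?c + \<eta> * (b * ?d)) - \<eta> * ((a * ?d + b * ?c) * (a * ?d + b * ?c)) =
      (a * a - \<eta> * (b * b)) * (?c * ?c - \<eta> * (?d * ?d))"
    by (simp add: algebra_simps)
  moreover have "det (k ** g) = (a * a - \<eta> * (b * b)) * det g"
    by (simp add: k' det_mul mult.assoc)
  moreover have "(k ** g) $ 1 $ 1 = a * ?c + \<eta> * (b * ?d)" "(k ** g) $ 2 $ 1 = a * ?d + b * ?c"
    by (simp_all add: k' matrix_mult_nth_2 mult.assoc add.commute)
  ultimately show ?thesis
    using N g \<nu>_mult[OF ab cd] by (simp add: sph_def cartan_char_def k')
qed

lemma sph_mem: "sph \<in> rep_space B.ind"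
  by (auto simp: B.mem_ind_iff sph_mult_borel) (simp add: sph_def)

lemma sph_eigenvector:
  assumes "k \<in> cartan_subgroup \<eta>"
  shows "rep_act B.ind k sph = fscale (cartan_char \<nu> k) sph"
proof
  fix h
  show "rep_act B.ind k sph h = fscale (cartan_char \<nu> k) sph h"
    using sph_mult_cartan[OF C.K_closed(2)[OF assms], of h] C.char_inv[OF assms]
    by (cases "det h = 0") (simp_all add: B.act_ind, simp add: sph_def)
qed

text \<open>Factoring \<open>h = k b\<close> with \<open>k\<close> in \<open>C\<close> and
  \<open>b\<close> in \<open>B\<close> computes any such eigenvector at \<open>h\<close> from its
  value at the identity. Applying this to both \<open>v\<close> and \<open>sph\<close> makes the
  factors agree.\<close>

lemma cartan_eigenvector_unique:
  assumes v: "v \<in> rep_space B.ind"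
    and vC: "\<And>k. k \<in> cartan_subgroup \<eta> \<Longrightarrow> rep_act B.ind k v = fscale (cartan_char \<nu> k) v"
  shows "v = fscale (v (mat2 1 0 0 1)) sph"
proof
  fix h
  show "v h = fscale (v (mat2 1 0 0 1)) sph h"
  proof (cases "det h = 0")
    case True
    then show ?thesis
      using v by (simp add: B.mem_ind_iff sph_def)
  next
    case False
    let ?a = "h $ 1 $ 1" and ?c = "h $ 2 $ 1"
    define k where "k = mat2 ?a (\<eta> * ?c) ?c ?a"
    define b where "b = inv\<^bsub>GL2\<^esub> k ** h"
    have k: "k \<in> cartan_subgroup \<eta>" and k1: "det k \<noteq> 0"
      using first_column_nonzero[OF False] norm_nonzero[OF first_column_nonzero[OF False]]
      by (auto simp: k_def cartan_subgroup_def mult.assoc)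
    have h: "h = k ** b" and db: "det b \<noteq> 0"
      using False k1 GL2.inv_solve_left'[of b k h] GL2.m_closed[of "inv\<^bsub>GL2\<^esub> k" h] GL2.inv_closed[of k]
      by (auto simp: b_def)
    \<comment> \<open>\<open>k\<close> and \<open>h\<close> share their first column, so
      \<open>b\<close> fixes the first basis vector; eliminating \<open>b\<^sub>1\<^sub>1\<close>
      isolates the lower left entry.\<close>
    have "b $ 2 $ 1 = 0"
    proof -
      have "(k ** b) $ 1 $ 1 = ?a * b $ 1 $ 1 + \<eta> * ?c * b $ 2 $ 1"
        "(k ** b) $ 2 $ 1 = ?c * b $ 1 $ 1 + ?a * b $ 2 $ 1"
        by (simp_all add: k_def matrix_mult_nth_2)
      then have e: "?a * b $ 1 $ 1 + \<eta> * ?c * b $ 2 $ 1 = ?a" "?c * b $ 1 $ 1 + ?a * b $ 2 $ 1 = ?c"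
        unfolding h[symmetric] by simp_all
      have "(?a * ?a - \<eta> * (?c * ?c)) * b $ 2 $ 1 =
          ?a * (?c * b $ 1 $ 1 + ?a * b $ 2 $ 1) - ?c * (?a * b $ 1 $ 1 + \<eta> * ?c * b $ 2 $ 1)"
        by (simp add: algebra_simps)
      also have "\<dots> = 0"
        unfolding e by simp
      finally have "(?a * ?a - \<eta> * (?c * ?c)) * b $ 2 $ 1 = 0" .
      then show ?thesis
        using norm_nonzero[OF first_column_nonzero[OF False]] by simp
    qed
    then have b: "b \<in> borel_subgroup"
      using db by (simp add: borel_subgroup_def)
    have f: "f h = cnj (borel_char \<psi>1 \<psi>2 b) * (cnj (cartan_char \<nu> k) * f (mat2 1 0 0 1))"
      if f: "f \<in> rep_space B.ind"
        "\<And>k. k \<in> cartan_subgroup \<eta> \<Longrightarrow> rep_act B.ind k f = fscale (cartan_char \<nu> k) f" for f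
    proof -
      have "rep_act B.ind (inv\<^bsub>GL2\<^esub> k) f (mat2 1 0 0 1) = f k"
        using k1 by (simp add: B.act_ind mat2_one[symmetric])
      then have "f k = cnj (cartan_char \<nu> k) * f (mat2 1 0 0 1)"
        using f(2)[OF C.K_closed(2)[OF k]] C.char_inv[OF k] by simp
      then show ?thesis
        using mult_borel_right[OF f(1) k1 b] h by simp
    qed
    show ?thesis
      using f[OF v vC] f[OF sph_mem sph_eigenvector] sph_one by simp
  qed
qed

text \<open>The Borel character is unimodular, so the summand is constant on cosets of
  \<open>B\<close>, and the division by the order of \<open>B\<close> cancels exactly.\<close>

lemma inner_borel_sum:
  assumes "u \<in> rep_space B.ind" "v \<in> rep_space B.ind"
  shows "rep_inner B.ind u v = u (mat2 1 0 0 1) * cnj (v (mat2 1 0 0 1)) +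
    (\<Sum>\<gamma>\<in>UNIV. u (mat2 \<gamma> \<eta> 1 \<gamma>) * cnj (v (mat2 \<gamma> \<eta> 1 \<gamma>)))"
proof -
  have "u (g ** b) * cnj (v (g ** b)) = u g * cnj (v g)" if "det g \<noteq> 0" "b \<in> borel_subgroup" for g b
  proof -
    have "u (g ** b) * cnj (v (g ** b)) =
        (borel_char \<psi>1 \<psi>2 b * cnj (borel_char \<psi>1 \<psi>2 b)) * (u g * cnj (v g))"
      by (simp add: mult_borel_right[OF _ that] assms)
    then show ?thesis
      using B.char_cnj[OF that(2)] by simp
  qed
  then have sum: "(\<Sum>g\<in>carrier GL2. u g * cnj (v g)) = of_nat (card (borel_subgroup :: ('a^2^2) set)) *
      (u (mat2 1 0 0 1) * cnj (v (mat2 1 0 0 1)) +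
       (\<Sum>\<gamma>\<in>UNIV. u (mat2 \<gamma> \<eta> 1 \<gamma>) * cnj (v (mat2 \<gamma> \<eta> 1 \<gamma>))))"
    by (rule sum_GL2_borel[OF not_square])
  have "of_nat (card (borel_subgroup :: ('a^2^2) set)) \<noteq> (0 :: complex)"
    using B.card_K unfolding of_nat_eq_0_iff by (rule gr_implies_not0)
  then show ?thesis
    unfolding B.inner_ind sum by (rule nonzero_mult_div_cancel_left)
qed

lemma square_diff_nonzero: "\<gamma> * \<gamma> - \<eta> \<noteq> 0"
  using not_square[of \<gamma>] by (simp add: power2_eq_square)

text \<open>Each of the \<open>q + 1\<close> coset representatives contributes 1.\<close>

lemma inner_sph_sph: "rep_inner B.ind sph sph = of_nat (CARD('a) + 1)"
  using square_diff_nonzero by (simp add: inner_borel_sum[OF sph_mem sph_mem] sph_norm sph_one)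

lemma inner_sph_affine:
  assumes x: "x \<noteq> 0"
  shows "rep_inner B.ind sph (rep_act B.ind (mat2 x y 0 1) sph) =
    (\<Sum>\<gamma>\<in>UNIV. \<nu> (\<gamma>, 1) * cnj (\<nu> (x * \<gamma> + y, 1)) *
       \<psi>2 (((x * \<gamma> + y)\<^sup>2 - \<eta>) / (x * (\<gamma>\<^sup>2 - \<eta>)))) + cnj (\<psi>1 x)"
proof -
  let ?n = "mat2 x y 0 1" and ?m = "mat2 (1 / x) (- y / x) 0 1"
  have "mat2 (1 / x) (- y / x) 0 1 ** ?n = mat2 1 0 0 1"
    using x by (simp add: mat2_eq_iff)
  then have inv: "inv\<^bsub>GL2\<^esub> ?n = ?m"
    using x by (intro GL2.inv_equality) simp_all
  have m: "?m \<in> borel_subgroup"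
    using x by (simp add: borel_subgroup_iff)
  have act: "rep_act B.ind ?n sph g = sph (?m ** g)" if "det g \<noteq> 0" for g
    using that by (simp add: B.act_ind inv)
  \<comment> \<open>The affine matrix lies in \<open>B\<close> and fixes the point at infinity; this
    coset yields the isolated \<psi>1 term of the formula.\<close>
  have 1: "rep_act B.ind ?n sph (mat2 1 0 0 1) = \<psi>1 x"
  proof -
    have "rep_act B.ind ?n sph (mat2 1 0 0 1) = cnj (\<psi>1 (1 / x))"
      using borel_vector_on_borel[OF sph_mem m]
      by (simp add: act borel_char_def sph_one Fstar_character_one \<psi>2)
    then show ?thesis
      using x Fstar_character_divide[OF \<psi>1, of 1 x] by (simp add: Fstar_character_one \<psi>1)
  qed
  \<comment> \<open>For a Cartan element the determinant equals the norm, so \<psi>2 is evaluated at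
    1.\<close>
  have 2: "sph (mat2 \<gamma> \<eta> 1 \<gamma>) = cnj (\<nu> (\<gamma>, 1))" for \<gamma>
    using square_diff_nonzero[of \<gamma>] by (simp add: sph_def Fstar_character_one \<psi>2)
  \<comment> \<open>The inverse affine map carries the point \<open>x * \<gamma> + y\<close> back to
    \<gamma>, so the first column becomes \<open>(\<gamma>, 1)\<close>; the determinant and the norm
    of that column supply the quotient inside \<psi>2.\<close>
  have 3: "rep_act B.ind ?n sph (mat2 (x * \<gamma> + y) \<eta> 1 (x * \<gamma> + y)) =
      cnj (\<nu> (\<gamma>, 1) * \<psi>2 (((x * \<gamma> + y)\<^sup>2 - \<eta>) / (x * (\<gamma>\<^sup>2 - \<eta>))))" for \<gamma>
  proof -
    let ?c = "mat2 (x * \<gamma> + y) \<eta> 1 (x * \<gamma> + y)"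
    have c: "det ?c = (x * \<gamma> + y)\<^sup>2 - \<eta>" "det ?c \<noteq> 0"
      using square_diff_nonzero[of "x * \<gamma> + y"] by (simp_all add: power2_eq_square)
    have "det (?m ** ?c) = ((x * \<gamma> + y)\<^sup>2 - \<eta>) / x"
      unfolding det_mul c by simp
    moreover have "(?m ** ?c) $ 1 $ 1 = \<gamma>" "(?m ** ?c) $ 2 $ 1 = 1"
      using x by (simp_all add: add_divide_distrib)
    ultimately show ?thesis
      using x c unfolding act[OF c(2)]
      by (simp add: sph_def power2_eq_square[of \<gamma>] del: mat2_mult)
  qed
  \<comment> \<open>Reindexing by this bijection removes the division by \<open>x\<close> from the
    arguments of \<nu>.\<close>
  have "bij (\<lambda>\<gamma>. x * \<gamma> + y)"
    using x by (intro bij_betw_byWitness[of _ "\<lambda>\<gamma>. (\<gamma> - y) / x"]) auto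
  then have sum: "(\<Sum>\<gamma>\<in>UNIV. sph (mat2 \<gamma> \<eta> 1 \<gamma>) * cnj (rep_act B.ind ?n sph (mat2 \<gamma> \<eta> 1 \<gamma>))) =
      (\<Sum>\<gamma>\<in>UNIV. sph (mat2 (x * \<gamma> + y) \<eta> 1 (x * \<gamma> + y)) *
        cnj (rep_act B.ind ?n sph (mat2 (x * \<gamma> + y) \<eta> 1 (x * \<gamma> + y))))"
    by (rule sum.reindex_bij_betw[of _ UNIV UNIV
        "\<lambda>\<gamma>. sph (mat2 \<gamma> \<eta> 1 \<gamma>) * cnj (rep_act B.ind ?n sph (mat2 \<gamma> \<eta> 1 \<gamma>))", symmetric])
  have "(\<Sum>\<gamma>\<in>UNIV. sph (mat2 \<gamma> \<eta> 1 \<gamma>) * cnj (rep_act B.ind ?n sph (mat2 \<gamma> \<eta> 1 \<gamma>))) =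
      (\<Sum>\<gamma>\<in>UNIV. \<nu> (\<gamma>, 1) * cnj (\<nu> (x * \<gamma> + y, 1)) *
       \<psi>2 (((x * \<gamma> + y)\<^sup>2 - \<eta>) / (x * (\<gamma>\<^sup>2 - \<eta>))))"
    unfolding sum unfolding 2 3 complex_cnj_mult complex_cnj_cnj by (simp only: mult_ac)
  moreover have "rep_act B.ind ?n sph \<in> rep_space B.ind"
    using unitary_closed[OF B.unitary_ind _ sph_mem, of ?n] x by simp
  ultimately show ?thesis
    by (simp add: inner_borel_sum[OF sph_mem] sph_one 1)
qed

text \<open>The right factor lies in \<open>C\<close> and acts on \<open>sph\<close> by a scalar,
  which leaves the second argument of the inner product conjugated.\<close>

lemma inner_sph_act:
  assumes x: "x \<noteq> 0" and ab: "(a, b) \<noteq> (0, 0)"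
  shows "rep_inner B.ind sph (rep_act B.ind (mat2 x y 0 1 ** mat2 a (\<eta> * b) b a) sph) =
    cnj (\<nu> (a, b)) *
    ((\<Sum>\<gamma>\<in>UNIV. \<nu> (\<gamma>, 1) * cnj (\<nu> (x * \<gamma> + y, 1)) *
       \<psi>2 (((x * \<gamma> + y)\<^sup>2 - \<eta>) / (x * (\<gamma>\<^sup>2 - \<eta>)))) + cnj (\<psi>1 x))"
proof -
  let ?n = "mat2 x y 0 1" and ?k = "mat2 a (\<eta> * b) b a"
  have k: "?k \<in> cartan_subgroup \<eta>"
    using ab by (auto simp: cartan_subgroup_def)
  have "rep_act B.ind (?n ** ?k) sph = rep_act B.ind ?n (rep_act B.ind ?k sph)"
    using unitary_mult[OF B.unitary_ind _ C.K_subset[OF k] sph_mem, of ?n] x by simp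
  also have "\<dots> = fscale (\<nu> (a, b)) (rep_act B.ind ?n sph)"
    using unitary_scale[OF B.unitary_ind _ sph_mem, of ?n] x
    by (simp add: sph_eigenvector[OF k] cartan_char_def)
  finally have "rep_inner B.ind sph (rep_act B.ind (?n ** ?k) sph) =
      cnj (\<nu> (a, b)) * rep_inner B.ind sph (rep_act B.ind ?n sph)"
    by (simp add: B.inner_ind sum_distrib_left mult_ac del: mat2_mult)
  then show ?thesis
    unfolding inner_sph_affine[OF x] .
qed

text \<open>The subspace \<open>W\<close> serves both families: it is the whole induced space or the
  complement of the determinant character. Once it contains \<open>sph\<close>, the matrix
  coefficient is the same computation.\<close>

lemma has_spherical_function_and_formula:
  assumes W: "cfun.subspace W" "W \<subseteq> rep_space B.ind" "sph \<in> W"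
      "\<And>g v. \<lbrakk>g \<in> carrier GL2; v \<in> W\<rbrakk> \<Longrightarrow> rep_act B.ind g v \<in> W"
    and irr: "irreducible_representation GL2 (B.ind\<lparr>rep_space := W\<rparr>)"
  shows "has_spherical_function GL2 (cartan_subgroup \<eta>) (cartan_char \<nu>) (B.ind\<lparr>rep_space := W\<rparr>)"
    and "\<lbrakk>x \<noteq> 0; (a, b) \<noteq> (0, 0)\<rbrakk> \<Longrightarrow>
      spherical_function (cartan_subgroup \<eta>) (cartan_char \<nu>) (B.ind\<lparr>rep_space := W\<rparr>)
        (mat2 x y 0 1 ** mat2 a (\<eta> * b) b a) =
      cnj (\<nu> (a, b)) / of_nat (CARD('a) + 1) *
        ((\<Sum>\<gamma>\<in>UNIV. \<nu> (\<gamma>, 1) * cnj (\<nu> (x * \<gamma> + y, 1)) *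
           \<psi>2 (((x * \<gamma> + y)\<^sup>2 - \<eta>) / (x * (\<gamma>\<^sup>2 - \<eta>)))) + cnj (\<psi>1 x))"
proof -
  let ?\<rho> = "B.ind\<lparr>rep_space := W\<rparr>" and ?q = "of_nat (CARD('a) + 1) :: complex"
  let ?s = "spherical_vector (cartan_subgroup \<eta>) (cartan_char \<nu>) ?\<rho>"
  have q: "?q \<noteq> 0"
    by (simp del: of_nat_add of_nat_Suc)
  have inner_scale: "rep_inner B.ind (fscale c u) (fscale c v) = c * cnj c * rep_inner B.ind u v" for c u v
    by (simp add: B.inner_ind sum_distrib_left mult_ac)
  have act_scale: "rep_act B.ind g (fscale c sph) = fscale c (rep_act B.ind g sph)"
    if "g \<in> carrier GL2" for g c
    using unitary_scale[OF B.unitary_ind that sph_mem] .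
  have unique: "\<exists>c. v = fscale c sph \<and> c * cnj c * ?q = 1" if v: "?s v" for v
  proof -
    have "v = fscale (v (mat2 1 0 0 1)) sph"
      using v W(2) by (intro cartan_eigenvector_unique) (auto simp: spherical_vector_def)
    moreover have "rep_inner B.ind v v = 1"
      using v by (simp add: spherical_vector_def)
    ultimately show ?thesis
      using inner_scale inner_sph_sph by metis
  qed
  \<comment> \<open>\<open>r\<close> normalizes \<open>sph\<close>, whose squared norm is
    \<open>q + 1\<close>.\<close>
  obtain r :: real where r: "r * r * real (CARD('a) + 1) = 1"
  proof
    show "1 / sqrt (real (CARD('a) + 1)) * (1 / sqrt (real (CARD('a) + 1))) * real (CARD('a) + 1) = 1"
      by simp
  qed
  have "of_real r * cnj (of_real r) * ?q = of_real (r * r * real (CARD('a) + 1))"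
    by simp
  then have r': "of_real r * cnj (of_real r) * ?q = 1"
    unfolding r by simp
  have ex: "?s (fscale (of_real r) sph)"
    unfolding spherical_vector_def
  proof (intro conjI ballI)
    show "rep_inner ?\<rho> (fscale (of_real r) sph) (fscale (of_real r) sph) = 1"
      using r' by (simp add: inner_scale inner_sph_sph del: of_nat_add)
    show "rep_act ?\<rho> k (fscale (of_real r) sph) = fscale (cartan_char \<nu> k) (fscale (of_real r) sph)"
      if "k \<in> cartan_subgroup \<eta>" for k
      using act_scale[OF C.K_subset[OF that]] sph_eigenvector[OF that] by (simp add: fun_eq_iff)
  qed (use W in \<open>simp add: cfun.subspace_scale\<close>)
  have "\<exists>c. cmod c = 1 \<and> w' = fscale c w" if w: "?s w" and w': "?s w'" for w w'
  proof -
    obtain c where c: "w = fscale c sph" "c * cnj c * ?q = 1"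
      using unique[OF w] by blast
    obtain d where d: "w' = fscale d sph" "d * cnj d * ?q = 1"
      using unique[OF w'] by blast
    \<comment> \<open>Both scalars satisfy the same normalization, so their quotient is the required
      phase.\<close>
    have "c * cnj c = d * cnj d"
      using c(2) d(2) q by (metis mult_right_cancel)
    then have "cmod c = cmod d"
      by (metis complex_norm_square norm_ge_zero of_real_eq_iff power2_eq_iff_nonneg)
    moreover have "c \<noteq> 0"
      using c(2) by auto
    ultimately show ?thesis
      by (intro exI[of _ "d / c"]) (auto simp: c d norm_divide fun_eq_iff)
  qed
  moreover have "unitary_representation GL2 ?\<rho>"
    using W by (intro unitary_representation_restrict B.unitary_ind) auto
  moreover from this have "contained_in_representation GL2 ?\<rho> C.ind"
    using irr ex C.char_inv by (intro contained_in_induced_rep group_GL2 subgroup_cartan) auto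
  ultimately show "has_spherical_function GL2 (cartan_subgroup \<eta>) (cartan_char \<nu>) ?\<rho>"
    unfolding has_spherical_function_def using irr ex by blast
  show "spherical_function (cartan_subgroup \<eta>) (cartan_char \<nu>) ?\<rho> (mat2 x y 0 1 ** mat2 a (\<eta> * b) b a) =
      cnj (\<nu> (a, b)) / ?q *
        ((\<Sum>\<gamma>\<in>UNIV. \<nu> (\<gamma>, 1) * cnj (\<nu> (x * \<gamma> + y, 1)) *
           \<psi>2 (((x * \<gamma> + y)\<^sup>2 - \<eta>) / (x * (\<gamma>\<^sup>2 - \<eta>)))) + cnj (\<psi>1 x))"
    if x: "x \<noteq> 0" and ab: "(a, b) \<noteq> (0, 0)"
  proof -
    let ?g = "mat2 x y 0 1 ** mat2 a (\<eta> * b) b a"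
    have g: "?g \<in> carrier GL2"
      unfolding GL2_simps det_mul using x norm_nonzero[OF ab] by (simp add: mult.assoc)
    \<comment> \<open>Whichever vector is chosen, only \<open>c * cnj c = 1 / (q + 1)\<close>
      survives in the matrix coefficient.\<close>
    obtain c where c: "(SOME w. ?s w) = fscale c sph" "c * cnj c * ?q = 1"
      using unique[OF someI[of ?s, OF ex]] by blast
    have "c * cnj c = 1 / ?q"
      using c(2) q by (simp add: eq_divide_eq del: of_nat_add)
    then have "spherical_function (cartan_subgroup \<eta>) (cartan_char \<nu>) ?\<rho> ?g =
        rep_inner B.ind sph (rep_act B.ind ?g sph) / ?q"
      by (simp add: spherical_function_def Let_def c(1) act_scale[OF g] inner_scale del: of_nat_add mat2_mult)
    then show ?thesis
      unfolding inner_sph_act[OF x ab] by (simp del: of_nat_add)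
  qed
qed

end

section \<open>The two families of spherical functions\<close>

lemma (in cartan_principal_series) parabolic_spherical_function:
  assumes "\<psi>1 \<noteq> \<psi>2"
  shows "has_spherical_function GL2 (cartan_subgroup \<eta>) (cartan_char \<nu>) (parabolic_rep \<psi>1 \<psi>2)"
    and "\<lbrakk>x \<noteq> 0; (a, b) \<noteq> (0, 0)\<rbrakk> \<Longrightarrow>
      spherical_function (cartan_subgroup \<eta>) (cartan_char \<nu>) (parabolic_rep \<psi>1 \<psi>2)
        (mat2 x y 0 1 ** mat2 a (\<eta> * b) b a) =
      cnj (\<nu> (a, b)) / of_nat (CARD('a) + 1) *
        ((\<Sum>\<gamma>\<in>UNIV. \<nu> (\<gamma>, 1) * cnj (\<nu> (x * \<gamma> + y, 1)) *
           \<psi>2 (((x * \<gamma> + y)\<^sup>2 - \<eta>) / (x * (\<gamma>\<^sup>2 - \<eta>)))) + cnj (\<psi>1 x))"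
proof -
  have eq: "B.ind\<lparr>rep_space := rep_space B.ind\<rparr> = parabolic_rep \<psi>1 \<psi>2"
    by (simp add: parabolic_rep_def)
  have "sph \<noteq> 0"
    using sph_one by auto
  then have "rep_space B.ind \<noteq> {0}"
    using sph_mem by blast
  then have "irreducible_representation GL2 (B.ind\<lparr>rep_space := rep_space B.ind\<rparr>)"
    using irreducible_parabolic[OF assms] by simp
  note * = has_spherical_function_and_formula[OF unitary_subspace[OF B.unitary_ind] order_refl sph_mem
      unitary_closed[OF B.unitary_ind] this, unfolded eq]
  show "has_spherical_function GL2 (cartan_subgroup \<eta>) (cartan_char \<nu>) (parabolic_rep \<psi>1 \<psi>2)"
    by (rule *(1))
  show "\<lbrakk>x \<noteq> 0; (a, b) \<noteq> (0, 0)\<rbrakk> \<Longrightarrow>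
      spherical_function (cartan_subgroup \<eta>) (cartan_char \<nu>) (parabolic_rep \<psi>1 \<psi>2)
        (mat2 x y 0 1 ** mat2 a (\<eta> * b) b a) =
      cnj (\<nu> (a, b)) / of_nat (CARD('a) + 1) *
        ((\<Sum>\<gamma>\<in>UNIV. \<nu> (\<gamma>, 1) * cnj (\<nu> (x * \<gamma> + y, 1)) *
           \<psi>2 (((x * \<gamma> + y)\<^sup>2 - \<eta>) / (x * (\<gamma>\<^sup>2 - \<eta>)))) + cnj (\<psi>1 x))"
    by (rule *(2))
qed

lemma parabolic_rep1_spherical_function:
  fixes \<eta> :: "'a::{field,finite}"
  assumes "cartan_principal_series \<eta> \<nu> \<psi> \<psi>" and indec: "\<not> decomposable \<eta> \<nu>"
  shows "has_spherical_function GL2 (cartan_subgroup \<eta>) (cartan_char \<nu>) (parabolic_rep1 \<psi>)"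
    and "\<lbrakk>x \<noteq> 0; (a, b) \<noteq> (0, 0)\<rbrakk> \<Longrightarrow>
      spherical_function (cartan_subgroup \<eta>) (cartan_char \<nu>) (parabolic_rep1 \<psi>)
        (mat2 x y 0 1 ** mat2 a (\<eta> * b) b a) =
      cnj (\<nu> (a, b)) / of_nat (CARD('a) + 1) *
        ((\<Sum>\<gamma>\<in>UNIV. \<nu> (\<gamma>, 1) * cnj (\<nu> (x * \<gamma> + y, 1)) *
           \<psi> (((x * \<gamma> + y)\<^sup>2 - \<eta>) / (x * (\<gamma>\<^sup>2 - \<eta>)))) + cnj (\<psi> x))"
proof -
  interpret cartan_principal_series \<eta> \<nu> \<psi> \<psi> by fact
  let ?W = "rep_space (parabolic_rep1 \<psi>)"
  have eq: "B.ind\<lparr>rep_space := ?W\<rparr> = parabolic_rep1 \<psi>"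
    by (simp add: parabolic_rep1_eq[OF \<psi>2])
  \<comment> \<open>The product of \<open>w\<close> and its conjugate is the determinant of the
    corresponding Cartan matrix, so indecomposability separates \<nu> from
    \<open>\<psi> \<circ> det\<close> on \<open>C\<close>.\<close>
  obtain k where k: "k \<in> cartan_subgroup \<eta>" "cartan_char \<nu> k \<noteq> \<psi> (det k)"
  proof -
    obtain w where "w \<in> carrier (Ring_Divisibility.mult_of (quad_ext \<eta>))"
        "\<nu> w \<noteq> \<psi> (fst (w \<otimes>\<^bsub>quad_ext \<eta>\<^esub> quad_conj w))"
      using indec \<psi>2 unfolding decomposable_def by blast
    then obtain c d where "(c, d) \<noteq> (0, 0)" "\<nu> (c, d) \<noteq> \<psi> (c * c - \<eta> * (d * d))"
      by (cases w) (simp add: quad_ext_def quad_conj_def)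
    then show ?thesis
      by (intro that[of "mat2 c (\<eta> * d) d c"]) (auto simp: cartan_subgroup_def cartan_char_def mult.assoc)
  qed
  have kG: "det k \<noteq> 0"
    using C.K_subset[OF k(1)] by simp
  have inv: "k ** inv\<^bsub>GL2\<^esub> k = mat 1" "inv\<^bsub>GL2\<^esub> k ** k = mat 1"
    using GL2.r_inv[of k] GL2.l_inv[of k] kG by (simp_all add: mat2_one)
  define S where "S = (\<Sum>g\<in>carrier GL2. sph g * \<psi> (det g))"
  \<comment> \<open>Left translation by \<open>k\<close> preserves the sum but multiplies it by a
    scalar different from 1, so \<open>S\<close> must vanish.\<close>
  have "S = (\<Sum>g\<in>carrier GL2. sph (k ** g) * \<psi> (det (k ** g)))"
    unfolding S_def using kG
    by (intro sum.reindex_bij_witness[of _ "\<lambda>g. k ** g" "\<lambda>g. inv\<^bsub>GL2\<^esub> k ** g"])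
      (auto simp: matrix_mul_assoc det_mul det_inv_GL2 inv)
  also have "\<dots> = (\<Sum>g\<in>carrier GL2. cnj (cartan_char \<nu> k) * \<psi> (det k) * (sph g * \<psi> (det g)))"
    using kG
    by (intro sum.cong) (auto simp: sph_mult_cartan[OF k(1)] det_mul Fstar_character_mult[OF \<psi>2])
  also have "\<dots> = cnj (cartan_char \<nu> k) * \<psi> (det k) * S"
    by (simp only: S_def sum_distrib_left)
  finally have "S = cnj (cartan_char \<nu> k) * \<psi> (det k) * S" .
  moreover have "cnj (cartan_char \<nu> k) * \<psi> (det k) \<noteq> 1"
  proof
    assume "cnj (cartan_char \<nu> k) * \<psi> (det k) = 1"
    then have "(cartan_char \<nu> k * cnj (cartan_char \<nu> k)) * \<psi> (det k) = cartan_char \<nu> k"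
      by (simp add: mult.assoc)
    then show False
      using k C.char_cnj[OF k(1)] by simp
  qed
  ultimately have "S = 0"
    by (metis mult_cancel_right1)
  then have sph: "sph \<in> ?W"
    using sph_mem by (simp add: parabolic_rep1_eq[OF \<psi>2] S_def)
  moreover have "sph \<noteq> 0"
    using sph_one by auto
  ultimately have "?W \<noteq> {0}"
    by blast
  then have irr: "irreducible_representation GL2 (B.ind\<lparr>rep_space := ?W\<rparr>)"
    using irreducible_parabolic_rep1[OF \<psi>2] eq by simp
  have WV: "?W \<subseteq> rep_space B.ind"
    by (auto simp: parabolic_rep1_eq[OF \<psi>2])
  note * = has_spherical_function_and_formula[OF subspace_parabolic_rep1[OF \<psi>2] WV sph
      parabolic_rep1_invariant[OF \<psi>2] irr, unfolded eq]
  show "has_spherical_function GL2 (cartan_subgroup \<eta>) (cartan_char \<nu>) (parabolic_rep1 \<psi>)"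
    by (rule *(1))
  show "\<lbrakk>x \<noteq> 0; (a, b) \<noteq> (0, 0)\<rbrakk> \<Longrightarrow>
      spherical_function (cartan_subgroup \<eta>) (cartan_char \<nu>) (parabolic_rep1 \<psi>)
        (mat2 x y 0 1 ** mat2 a (\<eta> * b) b a) =
      cnj (\<nu> (a, b)) / of_nat (CARD('a) + 1) *
        ((\<Sum>\<gamma>\<in>UNIV. \<nu> (\<gamma>, 1) * cnj (\<nu> (x * \<gamma> + y, 1)) *
           \<psi> (((x * \<gamma> + y)\<^sup>2 - \<eta>) / (x * (\<gamma>\<^sup>2 - \<eta>)))) + cnj (\<psi> x))"
    by (rule *(2))
qed

theorem theorem6p8:
  fixes \<eta> :: "'a::{field,finite}"
    and \<nu> :: "'a \<times> 'a \<Rightarrow> complex"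
  assumes "odd CARD('a)"
    and "field_generator \<eta>"
    and "\<nu> \<in> characters (Ring_Divisibility.mult_of (quad_ext \<eta>))"
    and "\<not> decomposable \<eta> \<nu>"
  shows
    "(\<forall>\<psi>1\<in>characters Fstar. \<forall>\<psi>2\<in>characters Fstar.
        \<psi>1 \<noteq> \<psi>2 \<longrightarrow> sharp \<nu> = (\<lambda>t\<in>carrier Fstar. \<psi>1 t * \<psi>2 t) \<longrightarrow>
        has_spherical_function GL2 (cartan_subgroup \<eta>) (cartan_char \<nu>) (parabolic_rep \<psi>1 \<psi>2) \<and>
        (\<forall>x y a b. x \<noteq> 0 \<longrightarrow> (a, b) \<noteq> (0, 0) \<longrightarrow>
           spherical_function (cartan_subgroup \<eta>) (cartan_char \<nu>) (parabolic_rep \<psi>1 \<psi>2)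
             (mat2 x y 0 1 ** mat2 a (\<eta> * b) b a) =
           cnj (\<nu> (a, b)) / of_nat (CARD('a) + 1) *
             ((\<Sum>\<gamma>\<in>UNIV. \<nu> (\<gamma>, 1) * cnj (\<nu> (x * \<gamma> + y, 1)) *
                 \<psi>2 (((x * \<gamma> + y)\<^sup>2 - \<eta>) / (x * (\<gamma>\<^sup>2 - \<eta>)))) + cnj (\<psi>1 x)))) \<and>
     (\<forall>\<psi>\<in>characters Fstar.
        sharp \<nu> = (\<lambda>t\<in>carrier Fstar. (\<psi> t)\<^sup>2) \<longrightarrow>
        has_spherical_function GL2 (cartan_subgroup \<eta>) (cartan_char \<nu>) (parabolic_rep1 \<psi>) \<and>
        (\<forall>x y a b. x \<noteq> 0 \<longrightarrow> (a, b) \<noteq> (0, 0) \<longrightarrow>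
           spherical_function (cartan_subgroup \<eta>) (cartan_char \<nu>) (parabolic_rep1 \<psi>)
             (mat2 x y 0 1 ** mat2 a (\<eta> * b) b a) =
           cnj (\<nu> (a, b)) / of_nat (CARD('a) + 1) *
             ((\<Sum>\<gamma>\<in>UNIV. \<nu> (\<gamma>, 1) * cnj (\<nu> (x * \<gamma> + y, 1)) *
                 \<psi> (((x * \<gamma> + y)\<^sup>2 - \<eta>) / (x * (\<gamma>\<^sup>2 - \<eta>)))) + cnj (\<psi> x))))"
proof -
  have principal: "cartan_principal_series \<eta> \<nu> \<psi>1 \<psi>2"
    if "\<psi>1 \<in> characters Fstar" "\<psi>2 \<in> characters Fstar"
      and eq: "sharp \<nu> = (\<lambda>t\<in>carrier Fstar. \<psi>1 t * \<psi>2 t)" for \<psi>1 \<psi>2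
  proof unfold_locales
    \<comment> \<open>The equality of restricted functions is used pointwise, at nonzero
      scalars.\<close>
    show "\<nu> (t, 0) = \<psi>1 t * \<psi>2 t" if "t \<noteq> 0" for t
      using fun_cong[OF eq, of t] that by (simp add: sharp_def)
  qed (use that assms generator_not_square[OF assms(1,2)] in auto)
  show ?thesis
  proof (intro conjI ballI impI allI)
    fix \<psi>1 \<psi>2 :: "'a \<Rightarrow> complex"
    assume *: "\<psi>1 \<in> characters Fstar" "\<psi>2 \<in> characters Fstar" "\<psi>1 \<noteq> \<psi>2"
      "sharp \<nu> = (\<lambda>t\<in>carrier Fstar. \<psi>1 t * \<psi>2 t)"
    note p = cartan_principal_series.parabolic_spherical_function[OF principal[OF *(1,2,4)] *(3)]
    show "has_spherical_function GL2 (cartan_subgroup \<eta>) (cartan_char \<nu>) (parabolic_rep \<psi>1 \<psi>2)"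
      by (rule p(1))
    fix x y a b :: 'a
    assume "x \<noteq> 0" "(a, b) \<noteq> (0, 0)"
    then show "spherical_function (cartan_subgroup \<eta>) (cartan_char \<nu>) (parabolic_rep \<psi>1 \<psi>2)
             (mat2 x y 0 1 ** mat2 a (\<eta> * b) b a) =
           cnj (\<nu> (a, b)) / of_nat (CARD('a) + 1) *
             ((\<Sum>\<gamma>\<in>UNIV. \<nu> (\<gamma>, 1) * cnj (\<nu> (x * \<gamma> + y, 1)) *
                 \<psi>2 (((x * \<gamma> + y)\<^sup>2 - \<eta>) / (x * (\<gamma>\<^sup>2 - \<eta>)))) + cnj (\<psi>1 x))"
      by (rule p(2))
  next
    fix \<psi> :: "'a \<Rightarrow> complex"
    assume *: "\<psi> \<in> characters Fstar" "sharp \<nu> = (\<lambda>t\<in>carrier Fstar. (\<psi> t)\<^sup>2)"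
    note p = parabolic_rep1_spherical_function[OF principal[OF *(1,1) *(2)[unfolded power2_eq_square]] assms(4)]
    show "has_spherical_function GL2 (cartan_subgroup \<eta>) (cartan_char \<nu>) (parabolic_rep1 \<psi>)"
      by (rule p(1))
    fix x y a b :: 'a
    assume "x \<noteq> 0" "(a, b) \<noteq> (0, 0)"
    then show "spherical_function (cartan_subgroup \<eta>) (cartan_char \<nu>) (parabolic_rep1 \<psi>)
             (mat2 x y 0 1 ** mat2 a (\<eta> * b) b a) =
           cnj (\<nu> (a, b)) / of_nat (CARD('a) + 1) *
             ((\<Sum>\<gamma>\<in>UNIV. \<nu> (\<gamma>, 1) * cnj (\<nu> (x * \<gamma> + y, 1)) *
                 \<psi> (((x * \<gamma> + y)\<^sup>2 - \<eta>) / (x * (\<gamma>\<^sup>2 - \<eta>)))) + cnj (\<psi> x))"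
      by (rule p(2))
  qed
qed

end
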